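(* For every positive integer $r$, $A_r$ is a tightly graded algebra.
   Context: $k$ is an algebraically closed field of characteristic 2. A finite dimensional $k$-algebra $A$ is tightly graded if there is an algebra isomorphism $A\cong\mathrm{gr}_{\mathrm{rad}A}(A)$, where $\mathrm{gr}_{\mathrm{rad}A}(A)$ is the graded algebra associated with the radical filtration. Equivalently, there is a positive grading $A=\bigoplus_{i\ge0}A_i$ with $A_0$ semisimple and $A$ generated as an algebra by $A_0$ and $A_1$. $A_r$ ($r\ge1$) is the quotient of the path algebra over $k$ (paths written left to right: $xy$ means first $x$, then $y$) of the quiver with vertices $1,2,3$ and arrows $a_1:1\to2$, $a_2:2\to1$, $b_1:1\to3$, $b_2:3\to1$, by the relations $a_2a_1=b_2b_1=0$, $(a_1a_2b_1b_2)^r=(b_1b_2a_1a_2)^r$. *)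

theory Defs
  imports
    "HOL-Algebra.Algebra"
    "Graph_Theory.Arc_Walk"
    "Jordan_Normal_Form.Missing_VectorSpace"
begin

section \<open>Algebras over a field\<close>

text \<open>The library locale \<^locale>\<open>algebra\<close> demands commutativity, hence a locale for
  associative unital algebras, which need not be commutative.\<close>

locale assoc_algebra = vectorspace K A + A: ring A for K (structure) and A (structure) +
  assumes smult_mult_left:
      "\<lbrakk>c \<in> carrier K; x \<in> carrier A; y \<in> carrier A\<rbrakk> \<Longrightarrow>
        (c \<odot>\<^bsub>A\<^esub> x) \<otimes>\<^bsub>A\<^esub> y = c \<odot>\<^bsub>A\<^esub> (x \<otimes>\<^bsub>A\<^esub> y)"
    and smult_mult_right:
      "\<lbrakk>c \<in> carrier K; x \<in> carrier A; y \<in> carrier A\<rbrakk> \<Longrightarrow>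
        x \<otimes>\<^bsub>A\<^esub> (c \<odot>\<^bsub>A\<^esub> y) = c \<odot>\<^bsub>A\<^esub> (x \<otimes>\<^bsub>A\<^esub> y)"

definition algebra_iso ::
  "('k, 'm) ring_scheme \<Rightarrow> ('k, 'a, 'n) module_scheme \<Rightarrow> ('k, 'b, 'l) module_scheme \<Rightarrow> ('a \<Rightarrow> 'b) set"
  where "algebra_iso K A B =
    {h \<in> ring_iso A B. \<forall>c \<in> carrier K. \<forall>x \<in> carrier A. h (c \<odot>\<^bsub>A\<^esub> x) = c \<odot>\<^bsub>B\<^esub> h x}"

definition coset_smult :: "('k, 'a, 'n) module_scheme \<Rightarrow> 'a set \<Rightarrow> 'k \<Rightarrow> 'a set \<Rightarrow> 'a set"
  where "coset_smult A I c S = (\<Union>x\<in>S. I +>\<^bsub>A\<^esub> (c \<odot>\<^bsub>A\<^esub> x))"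

definition quotient_algebra :: "('k, 'a, 'n) module_scheme \<Rightarrow> 'a set \<Rightarrow> ('k, 'a set) module"
  where "quotient_algebra A I =
    \<lparr>carrier = carrier (A Quot I), monoid.mult = monoid.mult (A Quot I), one = \<one>\<^bsub>A Quot I\<^esub>,
     ring.zero = \<zero>\<^bsub>A Quot I\<^esub>, ring.add = ring.add (A Quot I), smult = coset_smult A I\<rparr>"

text \<open>The same shape as the definition of \<^const>\<open>semiring_char\<close> for type classes.\<close>

definition ring_char :: "('k, 'm) ring_scheme \<Rightarrow> nat"
  where "ring_char R = Gcd {n::nat. add_pow R n \<one>\<^bsub>R\<^esub> = \<zero>\<^bsub>R\<^esub>}"


section \<open>The radical and the associated graded algebra\<close>

definition left_ideal :: "'a set \<Rightarrow> ('a, 'b) ring_scheme \<Rightarrow> bool"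
  where "left_ideal I R \<longleftrightarrow>
    additive_subgroup I R \<and> (\<forall>x \<in> carrier R. \<forall>a \<in> I. x \<otimes>\<^bsub>R\<^esub> a \<in> I)"

definition maximal_left_ideal :: "'a set \<Rightarrow> ('a, 'b) ring_scheme \<Rightarrow> bool"
  where "maximal_left_ideal I R \<longleftrightarrow>
    left_ideal I R \<and> I \<noteq> carrier R \<and>
    (\<forall>J. left_ideal J R \<and> I \<subseteq> J \<longrightarrow> J = I \<or> J = carrier R)"

text \<open>Intersecting with the carrier only matters for the zero ring.\<close>

definition jacobson_radical :: "('a, 'b) ring_scheme \<Rightarrow> 'a set"
  where "jacobson_radical R = carrier R \<inter> \<Inter>{I. maximal_left_ideal I R}"

primrec ideal_power :: "('a, 'b) ring_scheme \<Rightarrow> 'a set \<Rightarrow> nat \<Rightarrow> 'a set"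
  where
    "ideal_power R I 0 = carrier R"
  | "ideal_power R I (Suc n) = ideal_power R I n \<cdot>\<^bsub>R\<^esub> I"

text \<open>An element of the direct sum of the quotients \<open>I\<^sup>i / I\<^sup>i\<^sup>+\<^sup>1\<close> is a function sending
  \<open>i\<close> to a coset of \<open>I\<^sup>i\<^sup>+\<^sup>1\<close> contained in \<open>I\<^sup>i\<close>, equal to the zero coset \<open>I\<^sup>i\<^sup>+\<^sup>1\<close> for almost
  all \<open>i\<close>. Homogeneous components multiply by
  \<open>(x + I\<^sup>i\<^sup>+\<^sup>1) (y + I\<^sup>j\<^sup>+\<^sup>1) = x y + I\<^sup>i\<^sup>+\<^sup>j\<^sup>+\<^sup>1\<close>.\<close>

definition assoc_graded :: "('k, 'a, 'n) module_scheme \<Rightarrow> 'a set \<Rightarrow> ('k, nat \<Rightarrow> 'a set) module"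
  where "assoc_graded A I =
    \<lparr>carrier =
       {f. (\<forall>i. \<exists>x \<in> ideal_power A I i. f i = ideal_power A I (Suc i) +>\<^bsub>A\<^esub> x) \<and>
           finite {i. f i \<noteq> ideal_power A I (Suc i)}},
     monoid.mult = (\<lambda>f g n. \<Oplus>\<^bsub>A Quot ideal_power A I (Suc n)\<^esub>i \<in> {..n}.
               rcoset_mult A (ideal_power A I (Suc n)) (f i) (g (n - i))),
     one = (\<lambda>n. if n = 0 then ideal_power A I 1 +>\<^bsub>A\<^esub> \<one>\<^bsub>A\<^esub> else ideal_power A I (Suc n)),
     ring.zero = (\<lambda>n. ideal_power A I (Suc n)),
     ring.add = (\<lambda>f g n. f n <+>\<^bsub>A\<^esub> g n),
     smult = (\<lambda>c f n. coset_smult A (ideal_power A I (Suc n)) c (f n))\<rparr>"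

definition tightly_graded :: "('k, 'm) ring_scheme \<Rightarrow> ('k, 'a, 'n) module_scheme \<Rightarrow> bool"
  where "tightly_graded K A \<longleftrightarrow>
    assoc_algebra K A \<and> vectorspace.fin_dim K A \<and>
    algebra_iso K A (assoc_graded A (jacobson_radical A)) \<noteq> {}"


section \<open>Path algebras\<close>

text \<open>The path of arrows \<open>p\<close> from \<open>u\<close> to \<open>v\<close> is the triple \<open>(u, p, v)\<close>; \<open>p\<close> is empty for the
  trivial path at \<open>u = v\<close>. Paths compose from left to right.\<close>

type_synonym ('v, 'e) path = "'v \<times> 'e list \<times> 'v"

definition path_algebra ::
  "('k, 'm) ring_scheme \<Rightarrow> ('v, 'e) pre_digraph \<Rightarrow> ('k, ('v, 'e) path \<Rightarrow> 'k) module"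
  where "path_algebra K Q =
    \<lparr>carrier =
       {f. (\<forall>x. f x \<in> carrier K) \<and> finite {x. f x \<noteq> \<zero>\<^bsub>K\<^esub>} \<and>
           (\<forall>u p v. \<not> pre_digraph.awalk Q u p v \<longrightarrow> f (u, p, v) = \<zero>\<^bsub>K\<^esub>)},
     monoid.mult = (\<lambda>f g (u, p, w).
       \<Oplus>\<^bsub>K\<^esub>t \<in> {(p1, v, p2). pre_digraph.awalk Q u p1 v \<and>
           pre_digraph.awalk Q v p2 w \<and> p1 @ p2 = p}.
         case t of (p1, v, p2) \<Rightarrow> f (u, p1, v) \<otimes>\<^bsub>K\<^esub> g (v, p2, w)),
     one = (\<lambda>(u, p, v). if u \<in> verts Q \<and> p = [] \<and> v = u then \<one>\<^bsub>K\<^esub> else \<zero>\<^bsub>K\<^esub>),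
     ring.zero = (\<lambda>x. \<zero>\<^bsub>K\<^esub>),
     ring.add = (\<lambda>f g x. f x \<oplus>\<^bsub>K\<^esub> g x),
     smult = (\<lambda>c f x. c \<otimes>\<^bsub>K\<^esub> f x)\<rparr>"

definition arrow_elem ::
  "('k, 'm) ring_scheme \<Rightarrow> ('v, 'e) pre_digraph \<Rightarrow> 'e \<Rightarrow> ('v, 'e) path \<Rightarrow> 'k"
  where "arrow_elem K Q e =
    (\<lambda>x. if x = (tail Q e, [e], head Q e) then \<one>\<^bsub>K\<^esub> else \<zero>\<^bsub>K\<^esub>)"


section \<open>The algebras \<open>A\<^sub>r\<close>\<close>

datatype arrow = a\<^sub>1 | a\<^sub>2 | b\<^sub>1 | b\<^sub>2

definition quiver :: "(nat, arrow) pre_digraph"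
  where "quiver =
    \<lparr>verts = {1, 2, 3}, arcs = {a\<^sub>1, a\<^sub>2, b\<^sub>1, b\<^sub>2},
     tail = (\<lambda>e. case e of a\<^sub>1 \<Rightarrow> 1 | a\<^sub>2 \<Rightarrow> 2 | b\<^sub>1 \<Rightarrow> 1 | b\<^sub>2 \<Rightarrow> 3),
     head = (\<lambda>e. case e of a\<^sub>1 \<Rightarrow> 2 | a\<^sub>2 \<Rightarrow> 1 | b\<^sub>1 \<Rightarrow> 3 | b\<^sub>2 \<Rightarrow> 1)\<rparr>"

definition relations ::
  "('k, 'm) ring_scheme \<Rightarrow> nat \<Rightarrow> ((nat, arrow) path \<Rightarrow> 'k) set"
  where "relations K r =
    (let P = path_algebra K quiver; x = arrow_elem K quiver in
      {x a\<^sub>2 \<otimes>\<^bsub>P\<^esub> x a\<^sub>1,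
       x b\<^sub>2 \<otimes>\<^bsub>P\<^esub> x b\<^sub>1,
       (x a\<^sub>1 \<otimes>\<^bsub>P\<^esub> x a\<^sub>2 \<otimes>\<^bsub>P\<^esub> x b\<^sub>1 \<otimes>\<^bsub>P\<^esub> x b\<^sub>2) [^]\<^bsub>P\<^esub> r \<ominus>\<^bsub>P\<^esub>
       (x b\<^sub>1 \<otimes>\<^bsub>P\<^esub> x b\<^sub>2 \<otimes>\<^bsub>P\<^esub> x a\<^sub>1 \<otimes>\<^bsub>P\<^esub> x a\<^sub>2) [^]\<^bsub>P\<^esub> r})"

definition A_alg ::
  "('k, 'm) ring_scheme \<Rightarrow> nat \<Rightarrow> ('k, ((nat, arrow) path \<Rightarrow> 'k) set) module"
  where "A_alg K r =
    quotient_algebra (path_algebra K quiver) (genideal (path_algebra K quiver) (relations K r))"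

end

theory Submission
  imports Defs
begin

text \<open>
  All three relations of \<open>A\<^sub>r\<close> are homogeneous for the grading of the path algebra by the length of
  paths: two have degree 2, and in the third one both paths have length \<open>4 r\<close>. Hence the ideal
  they generate is homogeneous and \<open>A\<^sub>r\<close> inherits the grading. What has to be shown is that this
  grading, which exists by construction, is the one seen by the radical.

  Let \<open>F\<^sup>n\<close> be the span of all homogeneous elements of degree at least \<open>n\<close>. In a path algebra
  \<open>F\<^sup>n\<^sup>+\<^sup>1 = F\<^sup>n F\<^sup>1\<close>, because a path can be cut after its first \<open>n\<close> arrows, and this
  survives in quotients; so the powers of \<open>F\<^sup>1\<close> are the \<open>F\<^sup>n\<close>. Each quotient \<open>F\<^sup>n / F\<^sup>n\<^sup>+\<^sup>1\<close> is
  the degree \<open>n\<close> component, and sending \<open>x\<close> to the family of the cosets of its homogeneous parts is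
  an isomorphism onto the graded algebra of the \<open>F\<^sup>1\<close>-adic filtration (\<open>assoc_graded_iso\<close>).

  It remains to identify \<open>F\<^sup>1\<close> with the Jacobson radical of \<open>A\<^sub>r\<close> (\<open>jacobson_radical_eq_filt_1\<close>).
  A nilpotent ideal lies in every maximal left ideal. Conversely, reading off the coefficient at
  the trivial path of a vertex is an algebra homomorphism onto the field; its kernel is a maximal
  left ideal, and the intersection of these kernels over all vertices is \<open>F\<^sup>1\<close>.

  Both the nilpotency of \<open>F\<^sup>1\<close> and the finite dimension of \<open>A\<^sub>r\<close> follow once every path of
  length at least \<open>4 r + 1\<close> vanishes in \<open>A\<^sub>r\<close> (\<open>long_walk_in_I\<close>). A path that does not contain
  \<open>a\<^sub>2 a\<^sub>1\<close> or \<open>b\<^sub>2 b\<^sub>1\<close> has to run through the arrows in the cyclic order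
  \<open>a\<^sub>1, a\<^sub>2, b\<^sub>1, b\<^sub>2\<close>. If it is longer than \<open>4 r\<close>, it contains one side of the third relation
  next to a further arrow, and replacing that side by the other one creates \<open>a\<^sub>2 a\<^sub>1\<close> or
  \<open>b\<^sub>2 b\<^sub>1\<close>. For example \<open>(a\<^sub>1 a\<^sub>2 b\<^sub>1 b\<^sub>2)\<^sup>r a\<^sub>1 = (b\<^sub>1 b\<^sub>2 a\<^sub>1 a\<^sub>2)\<^sup>r a\<^sub>1 = 0\<close>.
\<close>

section \<open>Quotient algebras\<close>

text \<open>A self-map of \<open>A\<close> induces a map on cosets without a choice of representatives. Scalar
  multiplication on the quotient algebra and the homogeneous parts of its elements both have this
  form, so one lemma on well-definedness serves both.\<close>

definition coset_map :: "('a, 'm) ring_scheme \<Rightarrow> 'a set \<Rightarrow> ('a \<Rightarrow> 'a) \<Rightarrow> 'a set \<Rightarrow> 'a set"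
  where "coset_map A I \<phi> S = (\<Union>x\<in>S. I +>\<^bsub>A\<^esub> \<phi> x)"

lemma coset_smult_eq_coset_map: "coset_smult A I c = coset_map A I (\<lambda>x. c \<odot>\<^bsub>A\<^esub> x)"
  by (rule ext) (simp add: coset_smult_def coset_map_def)

lemma (in ideal) coset_map_coset:
  assumes closed: "\<And>x. x \<in> carrier R \<Longrightarrow> \<phi> x \<in> carrier R"
    and add: "\<And>x y. x \<in> carrier R \<Longrightarrow> y \<in> carrier R \<Longrightarrow> \<phi> (x \<oplus> y) = \<phi> x \<oplus> \<phi> y"
    and I: "\<And>x. x \<in> I \<Longrightarrow> \<phi> x \<in> I" and x: "x \<in> carrier R"
  shows "coset_map R I \<phi> (I +> x) = I +> \<phi> x"
proof -
  have "I +> \<phi> y = I +> \<phi> x" if y: "y \<in> I +> x" for y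
  proof -
    obtain i where i: "i \<in> I" "y = i \<oplus> x"
      using y by (auto simp: a_r_coset_def')
    then have "\<phi> y = \<phi> i \<oplus> \<phi> x"
      using x add Icarr by simp
    moreover have "\<phi> i \<in> carrier R" "\<phi> x \<in> carrier R"
      using i x closed Icarr by auto
    ultimately have "\<phi> y \<ominus> \<phi> x = \<phi> i"
      by (simp add: a_minus_def a_assoc r_neg)
    moreover have "y \<in> carrier R"
      using i x Icarr by simp
    ultimately show ?thesis
      using quotient_eq_iff_same_a_r_cos[OF ideal_axioms closed closed, of y x] I[OF i(1)] x
      by simp
  qed
  then have "coset_map R I \<phi> (I +> x) = (\<Union>y\<in>I +> x. I +> \<phi> x)"
    unfolding coset_map_def by (rule SUP_cong[OF refl])
  also have "\<dots> = I +> \<phi> x"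
    using a_rcos_self[OF x] by blast
  finally show ?thesis .
qed

lemma carrier_quotient_algebra:
  "carrier (quotient_algebra A I) = (\<lambda>x. I +>\<^bsub>A\<^esub> x) ` carrier A"
  by (auto simp: quotient_algebra_def FactRing_def A_RCOSETS_def')


context assoc_algebra
begin

text \<open>An ideal of the ring \<open>A\<close> is automatically a subspace, as \<open>c \<odot> x = (c \<odot> 1) x\<close>.\<close>

lemma ideal_smult_closed:
  assumes "ideal I A" "c \<in> carrier K" "x \<in> I"
  shows "c \<odot>\<^bsub>A\<^esub> x \<in> I"
proof -
  interpret I: ideal I A by fact
  have x: "x \<in> carrier A" using assms(3) by (rule I.Icarr)
  have "c \<odot>\<^bsub>A\<^esub> x = (c \<odot>\<^bsub>A\<^esub> \<one>\<^bsub>A\<^esub>) \<otimes>\<^bsub>A\<^esub> x"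
    using assms(2) x by (simp add: smult_mult_left)
  then show ?thesis
    using I.I_l_closed[OF assms(3), of "c \<odot>\<^bsub>A\<^esub> \<one>\<^bsub>A\<^esub>"] assms(2) by simp
qed

lemma
  assumes I: "ideal I A"
  shows quotient_add: "\<lbrakk>x \<in> carrier A; y \<in> carrier A\<rbrakk> \<Longrightarrow>
      (I +>\<^bsub>A\<^esub> x) \<oplus>\<^bsub>quotient_algebra A I\<^esub> (I +>\<^bsub>A\<^esub> y) = I +>\<^bsub>A\<^esub> (x \<oplus>\<^bsub>A\<^esub> y)"
    and quotient_mult: "\<lbrakk>x \<in> carrier A; y \<in> carrier A\<rbrakk> \<Longrightarrow>
      (I +>\<^bsub>A\<^esub> x) \<otimes>\<^bsub>quotient_algebra A I\<^esub> (I +>\<^bsub>A\<^esub> y) = I +>\<^bsub>A\<^esub> (x \<otimes>\<^bsub>A\<^esub> y)"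
    and quotient_smult: "\<lbrakk>c \<in> carrier K; x \<in> carrier A\<rbrakk> \<Longrightarrow>
      c \<odot>\<^bsub>quotient_algebra A I\<^esub> (I +>\<^bsub>A\<^esub> x) = I +>\<^bsub>A\<^esub> (c \<odot>\<^bsub>A\<^esub> x)"
    and quotient_one: "\<one>\<^bsub>quotient_algebra A I\<^esub> = I +>\<^bsub>A\<^esub> \<one>\<^bsub>A\<^esub>"
    and quotient_zero: "\<zero>\<^bsub>quotient_algebra A I\<^esub> = I"
proof -
  interpret I: ideal I A by fact
  show "\<lbrakk>x \<in> carrier A; y \<in> carrier A\<rbrakk> \<Longrightarrow>
      (I +>\<^bsub>A\<^esub> x) \<oplus>\<^bsub>quotient_algebra A I\<^esub> (I +>\<^bsub>A\<^esub> y) = I +>\<^bsub>A\<^esub> (x \<oplus>\<^bsub>A\<^esub> y)"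
    by (simp add: quotient_algebra_def FactRing_def I.a_rcos_sum)
  show "\<lbrakk>x \<in> carrier A; y \<in> carrier A\<rbrakk> \<Longrightarrow>
      (I +>\<^bsub>A\<^esub> x) \<otimes>\<^bsub>quotient_algebra A I\<^esub> (I +>\<^bsub>A\<^esub> y) = I +>\<^bsub>A\<^esub> (x \<otimes>\<^bsub>A\<^esub> y)"
    by (simp add: quotient_algebra_def FactRing_def I.rcoset_mult_add)
  show "c \<odot>\<^bsub>quotient_algebra A I\<^esub> (I +>\<^bsub>A\<^esub> x) = I +>\<^bsub>A\<^esub> (c \<odot>\<^bsub>A\<^esub> x)"
    if "c \<in> carrier K" "x \<in> carrier A"
    using I.coset_map_coset[of "\<lambda>x. c \<odot>\<^bsub>A\<^esub> x" x] that
    by (simp add: quotient_algebra_def coset_smult_eq_coset_map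
        smult_r_distr ideal_smult_closed[OF I])
qed (simp_all add: quotient_algebra_def FactRing_def)

lemma quotient_coset_eq_iff:
  assumes "ideal I A" "x \<in> carrier A" "y \<in> carrier A"
  shows "I +>\<^bsub>A\<^esub> x = I +>\<^bsub>A\<^esub> y \<longleftrightarrow> x \<ominus>\<^bsub>A\<^esub> y \<in> I"
  using A.quotient_eq_iff_same_a_r_cos[OF assms] by simp

lemma quotient_coset_eq_zero_iff:
  assumes "ideal I A" "x \<in> carrier A"
  shows "I +>\<^bsub>A\<^esub> x = I \<longleftrightarrow> x \<in> I"
  using A.a_rcos_zero[OF assms(1)] ideal.rcos_const_imp_mem[OF assms] by blast

lemma ring_quotient_algebra:
  assumes I: "ideal I A"
  shows "ring (quotient_algebra A I)"
proof -
  let ?B = "quotient_algebra A I"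
  interpret B: ring "A Quot I"
    using I by (rule ideal.quotient_is_ring)
  have sel: "carrier ?B = carrier (A Quot I)" "monoid.mult ?B = monoid.mult (A Quot I)"
    "ring.add ?B = ring.add (A Quot I)" "\<one>\<^bsub>?B\<^esub> = \<one>\<^bsub>A Quot I\<^esub>" "\<zero>\<^bsub>?B\<^esub> = \<zero>\<^bsub>A Quot I\<^esub>"
    by (simp_all add: quotient_algebra_def)
  show ?thesis
    by (intro ringI abelian_groupI monoidI; unfold sel)
      (simp_all add: B.a_assoc B.m_assoc B.l_distr B.r_distr B.add.l_inv_ex, rule B.a_comm)
qed

lemma assoc_algebra_quotient:
  assumes I: "ideal I A"
  shows "assoc_algebra K (quotient_algebra A I)"
proof -
  let ?B = "quotient_algebra A I"
  interpret B: ring ?B using I by (rule ring_quotient_algebra)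
  note simps = carrier_quotient_algebra quotient_add[OF I] quotient_mult[OF I] quotient_smult[OF I]
  have "module K ?B"
    by (rule moduleI[OF R.cring_axioms B.abelian_group_axioms])
      (auto simp: simps smult_l_distr smult_r_distr smult_assoc1)
  then have vs: "vectorspace K ?B"
    using field_axioms by (rule vectorspace.intro)
  have "assoc_algebra_axioms K ?B"
    by (rule assoc_algebra_axioms.intro) (auto simp: simps smult_mult_left smult_mult_right)
  with vs B.ring_axioms show ?thesis
    by (rule assoc_algebra.intro)
qed

lemma quotient_ring_hom:
  assumes I: "ideal I A"
  shows "ring_hom_ring A (quotient_algebra A I) (\<lambda>x. I +>\<^bsub>A\<^esub> x)"
proof (rule ring_hom_ringI2[OF A.ring_axioms ring_quotient_algebra[OF I]])
  show "(\<lambda>x. I +>\<^bsub>A\<^esub> x) \<in> ring_hom A (quotient_algebra A I)"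
    by (rule ring_hom_memI)
      (simp_all add: carrier_quotient_algebra quotient_add[OF I] quotient_mult[OF I] quotient_one[OF I])
qed

end

section \<open>Graded algebras\<close>

text \<open>The grading is given by its projections: \<open>part n x\<close> is the degree \<open>n\<close> component of \<open>x\<close>. That
  every element is the sum of finitely many components follows from \<open>part_finite\<close> and
  \<open>part_separates\<close>, so no direct sum has to be formed.\<close>

locale graded_algebra = assoc_algebra K A for K (structure) and A (structure) +
  fixes part :: "nat \<Rightarrow> 'c \<Rightarrow> 'c"
  assumes part_closed [simp]: "x \<in> carrier A \<Longrightarrow> part n x \<in> carrier A"
    and part_add: "\<lbrakk>x \<in> carrier A; y \<in> carrier A\<rbrakk> \<Longrightarrow> part n (x \<oplus>\<^bsub>A\<^esub> y) = part n x \<oplus>\<^bsub>A\<^esub> part n y"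
    and part_smult: "\<lbrakk>c \<in> carrier K; x \<in> carrier A\<rbrakk> \<Longrightarrow> part n (c \<odot>\<^bsub>A\<^esub> x) = c \<odot>\<^bsub>A\<^esub> part n x"
    and part_part: "x \<in> carrier A \<Longrightarrow> part m (part n x) = (if m = n then part n x else \<zero>\<^bsub>A\<^esub>)"
    and part_finite: "x \<in> carrier A \<Longrightarrow> \<exists>N. \<forall>n\<ge>N. part n x = \<zero>\<^bsub>A\<^esub>"
    and part_separates: "\<lbrakk>x \<in> carrier A; \<And>n. part n x = \<zero>\<^bsub>A\<^esub>\<rbrakk> \<Longrightarrow> x = \<zero>\<^bsub>A\<^esub>"
    and part_mult: "\<lbrakk>x \<in> carrier A; y \<in> carrier A\<rbrakk> \<Longrightarrow>
      part n (x \<otimes>\<^bsub>A\<^esub> y) = (\<Oplus>\<^bsub>A\<^esub>i\<in>{..n}. part i x \<otimes>\<^bsub>A\<^esub> part (n - i) y)"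
    and part_one: "part 0 \<one>\<^bsub>A\<^esub> = \<one>\<^bsub>A\<^esub>"
begin

text \<open>The two-sided ideal \<open>F\<^sup>n\<close> of elements whose components all have degree at least \<open>n\<close>.\<close>

definition filt :: "nat \<Rightarrow> 'c set"
  where "filt n = {x \<in> carrier A. \<forall>i<n. part i x = \<zero>\<^bsub>A\<^esub>}"

lemma filt_carrier: "x \<in> filt n \<Longrightarrow> x \<in> carrier A"
  by (simp add: filt_def)

lemma filt_0: "filt 0 = carrier A"
  by (simp add: filt_def)

lemma part_zero [simp]: "part n \<zero>\<^bsub>A\<^esub> = \<zero>\<^bsub>A\<^esub>"
proof -
  have "part n \<zero>\<^bsub>A\<^esub> = part n \<zero>\<^bsub>A\<^esub> \<oplus>\<^bsub>A\<^esub> part n \<zero>\<^bsub>A\<^esub>"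
    using part_add[of "\<zero>\<^bsub>A\<^esub>" "\<zero>\<^bsub>A\<^esub>" n] by simp
  then show ?thesis
    using M.add.l_cancel_one' part_closed M.zero_closed by blast
qed

lemma part_uminus:
  assumes "x \<in> carrier A"
  shows "part n (\<ominus>\<^bsub>A\<^esub> x) = \<ominus>\<^bsub>A\<^esub> part n x"
proof -
  have "part n (\<ominus>\<^bsub>A\<^esub> x) \<oplus>\<^bsub>A\<^esub> part n x = \<zero>\<^bsub>A\<^esub>"
    using part_add[of "\<ominus>\<^bsub>A\<^esub> x" x n] assms by (simp add: M.l_neg)
  then show ?thesis
    using assms by (intro M.minus_equality[symmetric]) simp_all
qed

lemma part_diff:
  "\<lbrakk>x \<in> carrier A; y \<in> carrier A\<rbrakk> \<Longrightarrow> part n (x \<ominus>\<^bsub>A\<^esub> y) = part n x \<ominus>\<^bsub>A\<^esub> part n y"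
  by (simp add: a_minus_def part_add part_uminus)

lemma part_finsum:
  assumes "finite S" "\<And>i. i \<in> S \<Longrightarrow> f i \<in> carrier A"
  shows "part n (\<Oplus>\<^bsub>A\<^esub>i\<in>S. f i) = (\<Oplus>\<^bsub>A\<^esub>i\<in>S. part n (f i))"
  using assms
proof (induction S rule: finite_induct)
  case (insert i S)
  then have "f \<in> S \<rightarrow> carrier A" "(\<lambda>i. part n (f i)) \<in> S \<rightarrow> carrier A"
    by auto
  with insert show ?case
    by (simp add: part_add)
qed simp

lemma part_sum_parts:
  assumes "finite S" "\<And>i. i \<in> S \<Longrightarrow> x i \<in> carrier A"
  shows "part n (\<Oplus>\<^bsub>A\<^esub>i\<in>S. part i (x i)) = (if n \<in> S then part n (x n) else \<zero>\<^bsub>A\<^esub>)"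
proof -
  have "part n (\<Oplus>\<^bsub>A\<^esub>i\<in>S. part i (x i)) = (\<Oplus>\<^bsub>A\<^esub>i\<in>S. part n (part i (x i)))"
    using assms by (intro part_finsum) auto
  also have "\<dots> = (\<Oplus>\<^bsub>A\<^esub>i\<in>S. if n = i then part i (x i) else \<zero>\<^bsub>A\<^esub>)"
    using assms by (intro M.finsum_cong') (auto simp: part_part)
  also have "\<dots> = (if n \<in> S then part n (x n) else \<zero>\<^bsub>A\<^esub>)"
  proof (cases "n \<in> S")
    case True
    then show ?thesis
      using assms M.finsum_singleton[of n S "\<lambda>i. part i (x i)"] by auto
  next
    case False
    then have "(\<Oplus>\<^bsub>A\<^esub>i\<in>S. if n = i then part i (x i) else \<zero>\<^bsub>A\<^esub>) = (\<Oplus>\<^bsub>A\<^esub>i\<in>S. \<zero>\<^bsub>A\<^esub>)"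
      by (intro M.finsum_cong') auto
    with False show ?thesis by (simp add: M.finsum_zero)
  qed
  finally show ?thesis .
qed

text \<open>If \<open>k < m + n\<close>, then in each term of the degree \<open>k\<close> component of \<open>x y\<close> either the factor from
  \<open>x\<close> has degree below \<open>m\<close> or the factor from \<open>y\<close> has degree below \<open>n\<close>.\<close>

lemma filt_mult:
  assumes x: "x \<in> filt m" and y: "y \<in> filt n"
  shows "x \<otimes>\<^bsub>A\<^esub> y \<in> filt (m + n)"
proof -
  have xy: "x \<in> carrier A" "y \<in> carrier A"
    using x y by (auto dest: filt_carrier)
  have "part k (x \<otimes>\<^bsub>A\<^esub> y) = \<zero>\<^bsub>A\<^esub>" if "k < m + n" for k
  proof -
    have "part i x \<otimes>\<^bsub>A\<^esub> part (k - i) y = \<zero>\<^bsub>A\<^esub>" if "i \<le> k" for i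
    proof (cases "i < m")
      case True
      then have "part i x = \<zero>\<^bsub>A\<^esub>" using x by (simp add: filt_def)
      then show ?thesis using xy by simp
    next
      case False
      then have "part (k - i) y = \<zero>\<^bsub>A\<^esub>"
        using y \<open>k < m + n\<close> \<open>i \<le> k\<close> by (simp add: filt_def)
      then show ?thesis using xy by simp
    qed
    then have "(\<Oplus>\<^bsub>A\<^esub>i\<in>{..k}. part i x \<otimes>\<^bsub>A\<^esub> part (k - i) y) = (\<Oplus>\<^bsub>A\<^esub>i\<in>{..k}. \<zero>\<^bsub>A\<^esub>)"
      by (intro M.finsum_cong') auto
    then show ?thesis
      by (simp add: part_mult xy M.finsum_zero)
  qed
  then show ?thesis
    using xy by (simp add: filt_def)
qed

lemma filt_ideal: "ideal (filt n) A"
proof (rule idealI[OF A.ring_axioms])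
  show "subgroup (filt n) (add_monoid A)"
    by (rule M.add.subgroupI)
      (auto simp: filt_def part_add part_uminus a_inv_def[symmetric] intro: exI[of _ "\<zero>\<^bsub>A\<^esub>"])
next
  fix a x assume "a \<in> filt n" "x \<in> carrier A"
  then show "x \<otimes>\<^bsub>A\<^esub> a \<in> filt n" "a \<otimes>\<^bsub>A\<^esub> x \<in> filt n"
    using filt_mult[of x 0 a n] filt_mult[of a n x 0] by (simp_all add: filt_0)
qed

lemma part_in_filt: "x \<in> carrier A \<Longrightarrow> part n x \<in> filt n"
  by (simp add: filt_def part_part)

lemma diff_part_in_filt:
  assumes "x \<in> filt n"
  shows "x \<ominus>\<^bsub>A\<^esub> part n x \<in> filt (Suc n)"
proof -
  have "x \<in> carrier A" using assms by (rule filt_carrier)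
  moreover have "part i x = \<zero>\<^bsub>A\<^esub>" if "i < n" for i
    using assms that by (simp add: filt_def)
  ultimately show ?thesis
    by (auto simp: filt_def part_diff part_part less_Suc_eq)
qed

lemma diff_truncation_in_filt:
  assumes "x \<in> carrier A"
  shows "x \<ominus>\<^bsub>A\<^esub> (\<Oplus>\<^bsub>A\<^esub>i\<in>{..<n}. part i x) \<in> filt n"
proof -
  have "(\<Oplus>\<^bsub>A\<^esub>i\<in>{..<n}. part i x) \<in> carrier A"
    using assms by (intro M.finsum_closed) auto
  then show ?thesis
    using assms part_sum_parts[of "{..<n}" "\<lambda>_. x"] by (auto simp: filt_def part_diff)
qed

lemma eq_iff_parts:
  assumes "x \<in> carrier A" "y \<in> carrier A"
  shows "x = y \<longleftrightarrow> (\<forall>n. part n x = part n y)"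
proof
  assume parts: "\<forall>n. part n x = part n y"
  have "part n (x \<ominus>\<^bsub>A\<^esub> y) = \<zero>\<^bsub>A\<^esub>" for n
    unfolding part_diff[OF assms] parts[rule_format, of n] using assms by simp
  with M.minus_closed[OF assms] have "x \<ominus>\<^bsub>A\<^esub> y = \<zero>\<^bsub>A\<^esub>"
    by (rule part_separates)
  then show "x = y" using assms by simp
qed simp

lemma sum_parts:
  assumes "x \<in> carrier A" "\<forall>n\<ge>N. part n x = \<zero>\<^bsub>A\<^esub>"
  shows "(\<Oplus>\<^bsub>A\<^esub>i\<in>{..<N}. part i x) = x"
proof -
  have c: "(\<Oplus>\<^bsub>A\<^esub>i\<in>{..<N}. part i x) \<in> carrier A"
    using assms by (intro M.finsum_closed) auto
  show ?thesis
    unfolding eq_iff_parts[OF c assms(1)]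
    using assms part_sum_parts[of "{..<N}" "\<lambda>_. x"] by simp
qed

subsection \<open>Homogeneous ideals\<close>

text \<open>The elements all of whose components lie in the ideal generated by \<open>S\<close> form an ideal, by the
  product formula for components. It contains \<open>S\<close>, hence the ideal generated by \<open>S\<close>.\<close>

lemma homogeneous_genideal:
  assumes S: "S \<subseteq> carrier A" and hom: "\<And>s n. s \<in> S \<Longrightarrow> part n s \<in> genideal A S"
    and x: "x \<in> genideal A S"
  shows "part n x \<in> genideal A S"
proof -
  let ?I = "genideal A S"
  interpret I: ideal ?I A using S by (rule A.genideal_ideal)
  let ?J = "{x \<in> carrier A. \<forall>n. part n x \<in> ?I}"
  have mult: "(\<Oplus>\<^bsub>A\<^esub>i\<in>{..n}. f i) \<in> ?I" if "\<And>i. f i \<in> ?I" for f and n :: nat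
    by (induction n) (use that I.Icarr in \<open>auto simp: M.finsum_Suc Pi_def\<close>)
  have "ideal ?J A"
  proof (rule idealI[OF A.ring_axioms])
    show "subgroup ?J (add_monoid A)"
      by (rule M.add.subgroupI)
        (auto simp: part_add part_uminus a_inv_def[symmetric] intro: exI[of _ "\<zero>\<^bsub>A\<^esub>"])
  next
    fix a x assume "a \<in> ?J" and x: "x \<in> carrier A"
    then have a: "a \<in> carrier A" "part n a \<in> ?I" for n
      by auto
    have "part n (x \<otimes>\<^bsub>A\<^esub> a) \<in> ?I" "part n (a \<otimes>\<^bsub>A\<^esub> x) \<in> ?I" for n
      unfolding part_mult[OF x a(1)] part_mult[OF a(1) x]
      using a x by (simp_all add: mult I.I_l_closed I.I_r_closed)
    then show "x \<otimes>\<^bsub>A\<^esub> a \<in> ?J" "a \<otimes>\<^bsub>A\<^esub> x \<in> ?J"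
      using a x by auto
  qed
  moreover have "S \<subseteq> ?J"
    using S hom by auto
  ultimately have "?I \<subseteq> ?J"
    by (rule A.genideal_minimal)
  with x show ?thesis by auto
qed

lemma graded_quotient:
  assumes I: "ideal I A" and hom: "\<And>x n. x \<in> I \<Longrightarrow> part n x \<in> I"
  shows "graded_algebra K (quotient_algebra A I) (\<lambda>n. coset_map A I (part n))"
proof -
  let ?B = "quotient_algebra A I" and ?q = "\<lambda>x. I +>\<^bsub>A\<^esub> x"
  interpret I: ideal I A by fact
  interpret q: ring_hom_ring A ?B ?q using I by (rule quotient_ring_hom)
  have part: "coset_map A I (part n) (?q x) = ?q (part n x)" if "x \<in> carrier A" for n x
    using that by (intro I.coset_map_coset) (auto simp: part_add hom)
  note carrier = carrier_quotient_algebra[of A I]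
  note zero = quotient_zero[OF I] quotient_coset_eq_zero_iff[OF I]
  \<comment> \<open>an element is the sum of its components, so it lies in \<open>I\<close> if they do\<close>
  have sep: "x \<in> I" if x: "x \<in> carrier A" and "\<And>n. part n x \<in> I" for x
  proof -
    obtain N where N: "\<forall>n\<ge>N. part n x = \<zero>\<^bsub>A\<^esub>" using part_finite[OF x] by blast
    have "(\<Oplus>\<^bsub>A\<^esub>i\<in>{..<k}. part i x) \<in> I" for k
      by (induction k) (use that(2) x in \<open>auto simp: lessThan_Suc Pi_def\<close>)
    from this[of N] show ?thesis by (simp only: sum_parts[OF x N])
  qed
  have "graded_algebra_axioms K ?B (\<lambda>n. coset_map A I (part n))"
  proof
    fix x n assume "x \<in> carrier ?B"
    then obtain y where y: "x = ?q y" "y \<in> carrier A" by (auto simp: carrier)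
    then show "coset_map A I (part n) x \<in> carrier ?B" by (simp add: part carrier)
    show "coset_map A I (part m) (coset_map A I (part n) x) =
        (if m = n then coset_map A I (part n) x else \<zero>\<^bsub>?B\<^esub>)" for m
      using y by (simp add: part part_part)
    obtain N where "\<forall>n\<ge>N. part n y = \<zero>\<^bsub>A\<^esub>" using part_finite y by blast
    then show "\<exists>N. \<forall>n\<ge>N. coset_map A I (part n) x = \<zero>\<^bsub>?B\<^esub>"
      using y by (intro exI[of _ N]) (simp add: part)
    show "coset_map A I (part n) (c \<odot>\<^bsub>?B\<^esub> x) = c \<odot>\<^bsub>?B\<^esub> coset_map A I (part n) x"
      if "c \<in> carrier K" for c
      using that y by (simp add: part quotient_smult[OF I] part_smult)
    show "x = \<zero>\<^bsub>?B\<^esub>" if "\<And>n. coset_map A I (part n) x = \<zero>\<^bsub>?B\<^esub>"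
      using that y sep[of y] by (simp add: part zero)
    fix x' assume "x' \<in> carrier ?B"
    then obtain y' where y': "x' = ?q y'" "y' \<in> carrier A" by (auto simp: carrier)
    show "coset_map A I (part n) (x \<oplus>\<^bsub>?B\<^esub> x') =
        coset_map A I (part n) x \<oplus>\<^bsub>?B\<^esub> coset_map A I (part n) x'"
      using y y' by (simp add: quotient_add[OF I] part part_add del: q.hom_add)
    have "?q (part n (y \<otimes>\<^bsub>A\<^esub> y')) = (\<Oplus>\<^bsub>?B\<^esub>i\<in>{..n}. ?q (part i y \<otimes>\<^bsub>A\<^esub> part (n - i) y'))"
      using y y' by (simp add: part_mult Pi_def comp_def)
    also have "\<dots> = (\<Oplus>\<^bsub>?B\<^esub>i\<in>{..n}. coset_map A I (part i) x \<otimes>\<^bsub>?B\<^esub> coset_map A I (part (n - i)) x')"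
      using y y' by (intro q.S.finsum_cong') (auto simp: part)
    finally show "coset_map A I (part n) (x \<otimes>\<^bsub>?B\<^esub> x') =
        (\<Oplus>\<^bsub>?B\<^esub>i\<in>{..n}. coset_map A I (part i) x \<otimes>\<^bsub>?B\<^esub> coset_map A I (part (n - i)) x')"
      using y y' by (simp add: quotient_mult[OF I] part del: q.hom_mult)
  next
    show "coset_map A I (part 0) \<one>\<^bsub>?B\<^esub> = \<one>\<^bsub>?B\<^esub>"
      by (simp add: quotient_one[OF I] part part_one del: q.hom_one)
  qed
  with assoc_algebra_quotient[OF I] show ?thesis
    by (rule graded_algebra.intro)
qed

text \<open>If the components of \<open>y\<close> in degrees below \<open>n\<close> lie in \<open>I\<close>, then removing them does not change the
  coset of \<open>y\<close> and yields a representative in \<open>F\<^sup>n\<close>.\<close>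

lemma filt_quotient:
  assumes I: "ideal I A" and hom: "\<And>x n. x \<in> I \<Longrightarrow> part n x \<in> I"
  shows "graded_algebra.filt (quotient_algebra A I) (\<lambda>n. coset_map A I (part n)) n =
    (\<lambda>x. I +>\<^bsub>A\<^esub> x) ` filt n"
proof -
  let ?B = "quotient_algebra A I" and ?q = "\<lambda>x. I +>\<^bsub>A\<^esub> x"
  interpret I: ideal I A by fact
  interpret B: graded_algebra K ?B "\<lambda>n. coset_map A I (part n)"
    using assms by (rule graded_quotient)
  have part: "coset_map A I (part n) (?q x) = ?q (part n x)" if "x \<in> carrier A" for n x
    using that by (intro I.coset_map_coset) (auto simp: part_add hom)
  have zero: "?q \<zero>\<^bsub>A\<^esub> = \<zero>\<^bsub>?B\<^esub>"
    by (simp add: quotient_zero[OF I] quotient_coset_eq_zero_iff[OF I])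
  show ?thesis
  proof (intro equalityI subsetI)
    fix x assume x: "x \<in> B.filt n"
    obtain y where y: "x = ?q y" "y \<in> carrier A"
      using B.filt_carrier[OF x] unfolding carrier_quotient_algebra by blast
    let ?t = "\<Oplus>\<^bsub>A\<^esub>i\<in>{..<n}. part i y"
    have parts: "part i y \<in> I" if "i < n" for i
      using x that y by (auto simp: B.filt_def part quotient_zero[OF I] quotient_coset_eq_zero_iff[OF I])
    have "(\<Oplus>\<^bsub>A\<^esub>i\<in>{..<k}. part i y) \<in> I" if "k \<le> n" for k
      using that by (induction k) (use parts y in \<open>auto simp: lessThan_Suc Pi_def\<close>)
    then have t: "?t \<in> I" by simp
    have "y \<ominus>\<^bsub>A\<^esub> (y \<ominus>\<^bsub>A\<^esub> ?t) = ?t"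
      using y(2) I.Icarr[OF t]
      by (simp only: a_minus_def M.minus_add M.r_neg2 M.minus_minus M.a_inv_closed)
    then have "x = ?q (y \<ominus>\<^bsub>A\<^esub> ?t)"
      using y t I.Icarr[OF t] by (simp add: quotient_coset_eq_iff[OF I])
    then show "x \<in> ?q ` filt n"
      using diff_truncation_in_filt[OF y(2), of n] by blast
  next
    fix x assume "x \<in> ?q ` filt n"
    then show "x \<in> B.filt n"
      by (auto simp: filt_def B.filt_def part zero carrier_quotient_algebra)
  qed
qed

end

section \<open>The Jacobson radical\<close>

text \<open>A nilpotent ideal lies in every maximal left ideal \<open>M\<close>. Otherwise \<open>1 = m + f\<close> with \<open>m \<in> M\<close> and
  \<open>f\<close> in the ideal; multiplying by powers of \<open>f\<close> pushes \<open>f\<close> down the filtration until it is \<open>0\<close>,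
  so that \<open>1 \<in> M\<close>.\<close>

lemma (in ring) nilpotent_filtration_le_maximal_left_ideal:
  assumes max: "maximal_left_ideal M R"
    and ideal: "\<And>n. ideal (F n) R"
    and mult: "\<And>n x y. x \<in> F n \<Longrightarrow> y \<in> F (Suc 0) \<Longrightarrow> x \<otimes> y \<in> F (Suc n)"
    and F0: "F 0 = carrier R" and nil: "F N = {\<zero>}"
  shows "F (Suc 0) \<subseteq> M"
proof (rule ccontr)
  assume "\<not> F (Suc 0) \<subseteq> M"
  then obtain z where z: "z \<in> F (Suc 0)" "z \<notin> M" by blast
  have left: "additive_subgroup M R" "\<And>x a. x \<in> carrier R \<Longrightarrow> a \<in> M \<Longrightarrow> x \<otimes> a \<in> M"
    and proper: "M \<noteq> carrier R"
    and maximal: "\<And>J. left_ideal J R \<Longrightarrow> M \<subseteq> J \<Longrightarrow> J = M \<or> J = carrier R"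
    using max by (auto simp: maximal_left_ideal_def left_ideal_def)
  interpret M: additive_subgroup M R by fact
  interpret F: ideal "F (Suc 0)" R by (rule ideal)
  let ?J = "M <+>\<^bsub>R\<^esub> F (Suc 0)"
  have J: "additive_subgroup ?J R"
    using left(1) F.additive_subgroup_axioms by (rule add_additive_subgroups)
  have "left_ideal ?J R"
    unfolding left_ideal_def
  proof (intro conjI ballI J)
    fix x a assume x: "x \<in> carrier R" and "a \<in> ?J"
    then obtain m f where a: "m \<in> M" "f \<in> F (Suc 0)" "a = m \<oplus> f"
      by (auto simp: set_add_def')
    then have "x \<otimes> a = x \<otimes> m \<oplus> x \<otimes> f"
      using x M.a_Hcarr F.Icarr by (simp add: r_distr)
    moreover have "x \<otimes> m \<in> M" "x \<otimes> f \<in> F (Suc 0)"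
      using x a left(2) F.I_l_closed by auto
    ultimately show "x \<otimes> a \<in> ?J"
      by (auto simp: set_add_def')
  qed
  moreover have "M \<subseteq> ?J"
  proof
    fix m assume "m \<in> M"
    then have "m = m \<oplus> \<zero>" using M.a_Hcarr by simp
    with \<open>m \<in> M\<close> F.zero_closed show "m \<in> ?J" unfolding set_add_def' by blast
  qed
  moreover have "z \<in> ?J"
  proof -
    have "z = \<zero> \<oplus> z" using z F.Icarr by simp
    with z M.zero_closed show ?thesis unfolding set_add_def' by blast
  qed
  ultimately have "?J = carrier R"
    using maximal z by blast
  then have "\<one> \<in> ?J" by simp
  then obtain m f where mf: "m \<in> M" "f \<in> F (Suc 0)" "\<one> = m \<oplus> f"
    by (auto simp: set_add_def')
  have carr: "m \<in> carrier R" "f \<in> carrier R"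
    using mf M.a_Hcarr F.Icarr by auto
  \<comment> \<open>modulo \<open>M\<close>, the unit element is congruent to elements arbitrarily deep in the filtration: if
    it is congruent to \<open>g\<close>, then it is congruent to \<open>g f\<close>, because \<open>g = g m + g f\<close> and \<open>g m \<in> M\<close>\<close>
  have "\<exists>g \<in> F k. \<one> \<ominus> g \<in> M" for k
  proof (induction k)
    case 0
    have "\<one> \<ominus> \<one> \<in> M" by (simp add: a_minus_def r_neg)
    then show ?case using F0 by auto
  next
    case (Suc k)
    then obtain g where g: "g \<in> F k" "\<one> \<ominus> g \<in> M" by blast
    have gc: "g \<in> carrier R" using g ideal.Icarr[OF ideal] by blast
    have "g = g \<otimes> (m \<oplus> f)" using gc by (simp flip: mf(3))
    then have "g = g \<otimes> m \<oplus> g \<otimes> f" using gc carr by (simp add: r_distr)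
    moreover have "\<one> \<ominus> g \<otimes> f = (\<one> \<ominus> (g \<otimes> m \<oplus> g \<otimes> f)) \<oplus> g \<otimes> m"
      using gc carr by algebra
    ultimately have "\<one> \<ominus> g \<otimes> f = (\<one> \<ominus> g) \<oplus> g \<otimes> m"
      by simp
    then have "\<one> \<ominus> g \<otimes> f \<in> M"
      using g left(2)[OF gc mf(1)] by simp
    moreover have "g \<otimes> f \<in> F (Suc k)" using g mf by (intro mult)
    ultimately show ?case by blast
  qed
  from this[of N] have "\<one> \<in> M"
    using nil by (auto simp: a_minus_def)
  then have "x \<in> M" if "x \<in> carrier R" for x
    using left(2)[OF that, of \<one>] that by simp
  then show False
    using proper M.a_subset by blast
qed

text \<open>A left ideal that is larger than the kernel contains some \<open>j\<close> with \<open>h j \<noteq> 0\<close>. For \<open>a\<close> in the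
  preimage of the inverse of \<open>h j\<close>, both \<open>a j\<close> and the kernel element \<open>1 - a j\<close> lie in it.\<close>

lemma kernel_maximal_left_ideal:
  assumes h: "ring_hom_ring R L h" and "field L" and surj: "h ` carrier R = carrier L"
  shows "maximal_left_ideal {x \<in> carrier R. h x = \<zero>\<^bsub>L\<^esub>} R"
proof -
  interpret h: ring_hom_ring R L h by fact
  interpret L: field L by fact
  let ?M = "{x \<in> carrier R. h x = \<zero>\<^bsub>L\<^esub>}"
  have "subgroup ?M (add_monoid R)"
    by (rule h.R.add.subgroupI) (auto simp: a_inv_def[symmetric] intro: exI[of _ "\<zero>\<^bsub>R\<^esub>"])
  then have "left_ideal ?M R"
    by (auto simp: left_ideal_def intro: additive_subgroup.intro)
  moreover have "?M \<noteq> carrier R"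
    using h.R.one_closed by force
  moreover have "J = carrier R" if J: "left_ideal J R" "?M \<subseteq> J" "J \<noteq> ?M" for J
  proof -
    have left: "additive_subgroup J R" "\<And>x a. x \<in> carrier R \<Longrightarrow> a \<in> J \<Longrightarrow> x \<otimes>\<^bsub>R\<^esub> a \<in> J"
      using J by (auto simp: left_ideal_def)
    interpret J: additive_subgroup J R by fact
    obtain j where j: "j \<in> J" "j \<notin> ?M" using J by blast
    then have jc: "j \<in> carrier R" "h j \<in> Units L"
      using J.a_Hcarr L.field_Units by auto
    then obtain a where a: "a \<in> carrier R" "h a = inv\<^bsub>L\<^esub> h j"
      using surj h.S.Units_inv_closed by (metis imageE)
    have aj: "a \<otimes>\<^bsub>R\<^esub> j \<in> J" using a j left by simp
    have "h (\<one>\<^bsub>R\<^esub> \<ominus>\<^bsub>R\<^esub> a \<otimes>\<^bsub>R\<^esub> j) = \<zero>\<^bsub>L\<^esub>"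
      using a jc h.S.Units_l_inv by (simp add: a_minus_def h.S.r_neg)
    then have "\<one>\<^bsub>R\<^esub> \<ominus>\<^bsub>R\<^esub> a \<otimes>\<^bsub>R\<^esub> j \<in> ?M"
      using a jc by simp
    then have "\<one>\<^bsub>R\<^esub> \<ominus>\<^bsub>R\<^esub> a \<otimes>\<^bsub>R\<^esub> j \<in> J"
      using J(2) by blast
    then have "(\<one>\<^bsub>R\<^esub> \<ominus>\<^bsub>R\<^esub> a \<otimes>\<^bsub>R\<^esub> j) \<oplus>\<^bsub>R\<^esub> a \<otimes>\<^bsub>R\<^esub> j \<in> J"
      using aj by (rule J.a_closed)
    then have "\<one>\<^bsub>R\<^esub> \<in> J"
      using a jc by (simp add: a_minus_def h.R.a_assoc h.R.l_neg)
    then have "x \<in> J" if "x \<in> carrier R" for x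
      using left(2)[OF that, of "\<one>\<^bsub>R\<^esub>"] that by simp
    then show ?thesis using J.a_subset by blast
  qed
  ultimately show ?thesis
    by (auto simp: maximal_left_ideal_def)
qed

context graded_algebra
begin

text \<open>The inclusion of \<open>F\<^sup>1\<close> in the radical is nilpotency. For the other one it suffices to have a
  family of homomorphisms onto the field, which play the role of the simple modules, with common
  kernel contained in \<open>F\<^sup>1\<close>.\<close>

lemma jacobson_radical_eq_filt_1:
  assumes nil: "filt N = {\<zero>\<^bsub>A\<^esub>}"
    and hom: "\<And>\<chi>. \<chi> \<in> H \<Longrightarrow> ring_hom_ring A K \<chi>"
    and surj: "\<And>\<chi>. \<chi> \<in> H \<Longrightarrow> \<chi> ` carrier A = carrier K"
    and ker: "\<And>x. x \<in> carrier A \<Longrightarrow> (\<And>\<chi>. \<chi> \<in> H \<Longrightarrow> \<chi> x = \<zero>\<^bsub>K\<^esub>) \<Longrightarrow> x \<in> filt 1"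
  shows "jacobson_radical A = filt 1"
proof
  show "filt 1 \<subseteq> jacobson_radical A"
  proof -
    have "filt (Suc 0) \<subseteq> M" if "maximal_left_ideal M A" for M
    proof (rule A.nilpotent_filtration_le_maximal_left_ideal[OF that filt_ideal _ filt_0 nil])
      show "x \<otimes>\<^bsub>A\<^esub> y \<in> filt (Suc n)" if "x \<in> filt n" "y \<in> filt (Suc 0)" for n x y
        using filt_mult[OF that] by simp
    qed
    then show ?thesis
      by (auto simp: jacobson_radical_def dest: filt_carrier)
  qed
  show "jacobson_radical A \<subseteq> filt 1"
  proof
    fix x assume x: "x \<in> jacobson_radical A"
    show "x \<in> filt 1"
    proof (rule ker)
      show "x \<in> carrier A" using x by (simp add: jacobson_radical_def)
      show "\<chi> x = \<zero>\<^bsub>K\<^esub>" if "\<chi> \<in> H" for \<chi>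
        using x kernel_maximal_left_ideal[OF hom[OF that] field_axioms surj[OF that]]
        by (auto simp: jacobson_radical_def)
    qed
  qed
qed

section \<open>Gradings and radical filtrations\<close>

text \<open>Here \<open>gen\<close> says that the algebra is generated in degrees 0 and 1.\<close>

lemma ideal_power_filt_1:
  assumes gen: "\<And>n. filt (Suc n) \<subseteq> filt n \<cdot>\<^bsub>A\<^esub> filt 1"
  shows "ideal_power A (filt 1) n = filt n"
proof (induction n)
  case (Suc n)
  have "x \<in> filt (Suc n)" if "x \<in> filt n \<cdot>\<^bsub>A\<^esub> filt 1" for x
    using that
  proof induction
    case (prod i j)
    then show ?case using filt_mult[of i n j 1] by simp
  next
    case (sum x y)
    then show ?case
      using additive_subgroup.a_closed[OF ideal.axioms(1)[OF filt_ideal]] by blast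
  qed
  with gen Suc show ?case by auto
qed (simp add: filt_0)

lemma filt_mono: "m \<le> n \<Longrightarrow> filt n \<subseteq> filt m"
  by (auto simp: filt_def)

text \<open>The product of cosets in the graded algebra is formed in the quotient by \<open>F\<^sup>i\<^sup>+\<^sup>j\<^sup>+\<^sup>1\<close>, whereas the
  factors are cosets of the larger ideals \<open>F\<^sup>i\<^sup>+\<^sup>1\<close> and \<open>F\<^sup>j\<^sup>+\<^sup>1\<close>. It is nevertheless a single
  coset: changing \<open>a\<close> by \<open>u \<in> F\<^sup>i\<^sup>+\<^sup>1\<close> and \<open>b\<close> by \<open>v \<in> F\<^sup>j\<^sup>+\<^sup>1\<close> changes \<open>a b\<close> by
  \<open>u v + u b + a v\<close>, which lies in \<open>F\<^sup>i\<^sup>+\<^sup>j\<^sup>+\<^sup>1\<close>.\<close>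

lemma rcoset_mult_filt:
  assumes a: "a \<in> filt i" and b: "b \<in> filt j"
  shows "rcoset_mult A (filt (Suc (i + j))) (filt (Suc i) +>\<^bsub>A\<^esub> a) (filt (Suc j) +>\<^bsub>A\<^esub> b) =
    filt (Suc (i + j)) +>\<^bsub>A\<^esub> (a \<otimes>\<^bsub>A\<^esub> b)"
proof -
  let ?F = "filt (Suc (i + j))"
  interpret F: ideal ?F A by (rule filt_ideal)
  interpret Fi: ideal "filt (Suc i)" A by (rule filt_ideal)
  interpret Fj: ideal "filt (Suc j)" A by (rule filt_ideal)
  have carr: "a \<in> carrier A" "b \<in> carrier A"
    using a b by (auto dest: filt_carrier)
  have eq: "?F +>\<^bsub>A\<^esub> (a' \<otimes>\<^bsub>A\<^esub> b') = ?F +>\<^bsub>A\<^esub> (a \<otimes>\<^bsub>A\<^esub> b)"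
    if a': "a' \<in> filt (Suc i) +>\<^bsub>A\<^esub> a" and b': "b' \<in> filt (Suc j) +>\<^bsub>A\<^esub> b" for a' b'
  proof -
    obtain u where u: "u \<in> filt (Suc i)" "a' = u \<oplus>\<^bsub>A\<^esub> a"
      using a' by (auto simp: a_r_coset_def')
    obtain v where v: "v \<in> filt (Suc j)" "b' = v \<oplus>\<^bsub>A\<^esub> b"
      using b' by (auto simp: a_r_coset_def')
    have uv: "u \<in> carrier A" "v \<in> carrier A"
      using u v by (auto dest: filt_carrier)
    have "(u \<oplus>\<^bsub>A\<^esub> a) \<otimes>\<^bsub>A\<^esub> (v \<oplus>\<^bsub>A\<^esub> b) \<ominus>\<^bsub>A\<^esub> a \<otimes>\<^bsub>A\<^esub> b =
        u \<otimes>\<^bsub>A\<^esub> v \<oplus>\<^bsub>A\<^esub> (u \<otimes>\<^bsub>A\<^esub> b \<oplus>\<^bsub>A\<^esub> a \<otimes>\<^bsub>A\<^esub> v)"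
      using carr uv by algebra
    moreover have "u \<otimes>\<^bsub>A\<^esub> v \<in> ?F" "u \<otimes>\<^bsub>A\<^esub> b \<in> ?F" "a \<otimes>\<^bsub>A\<^esub> v \<in> ?F"
      using filt_mult[OF u(1) v(1)] filt_mult[OF u(1) b] filt_mult[OF a v(1)]
        filt_mono[of "Suc (i + j)" "Suc i + Suc j"] by auto
    ultimately have "a' \<otimes>\<^bsub>A\<^esub> b' \<ominus>\<^bsub>A\<^esub> a \<otimes>\<^bsub>A\<^esub> b \<in> ?F"
      using u v by simp
    then show ?thesis
      using u v uv carr by (simp add: quotient_coset_eq_iff[OF filt_ideal])
  qed
  have "rcoset_mult A ?F (filt (Suc i) +>\<^bsub>A\<^esub> a) (filt (Suc j) +>\<^bsub>A\<^esub> b) =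
      (\<Union>a'\<in>filt (Suc i) +>\<^bsub>A\<^esub> a. \<Union>b'\<in>filt (Suc j) +>\<^bsub>A\<^esub> b. ?F +>\<^bsub>A\<^esub> (a \<otimes>\<^bsub>A\<^esub> b))"
    unfolding rcoset_mult_def by (intro SUP_cong refl eq)
  also have "\<dots> = ?F +>\<^bsub>A\<^esub> (a \<otimes>\<^bsub>A\<^esub> b)"
    using Fi.a_rcos_self[OF carr(1)] Fj.a_rcos_self[OF carr(2)] by blast
  finally show ?thesis .
qed

text \<open>The degree \<open>n\<close> component is a complement of \<open>F\<^sup>n\<^sup>+\<^sup>1\<close> in \<open>F\<^sup>n\<close>. So the coset of \<open>part n x\<close>
  determines \<open>part n x\<close>, which gives injectivity; and a coset represented by \<open>z \<in> F\<^sup>n\<close> is also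
  represented by \<open>part n z\<close>, which gives surjectivity.\<close>

lemma assoc_graded_iso:
  assumes gen: "\<And>n. filt (Suc n) \<subseteq> filt n \<cdot>\<^bsub>A\<^esub> filt 1"
  shows "(\<lambda>x n. filt (Suc n) +>\<^bsub>A\<^esub> part n x) \<in> algebra_iso K A (assoc_graded A (filt 1))"
proof -
  let ?G = "assoc_graded A (filt 1)" and ?h = "\<lambda>x n. filt (Suc n) +>\<^bsub>A\<^esub> part n x"
  note power = ideal_power_filt_1[OF gen]
  have power1: "ideal_power A (filt 1) 1 = filt (Suc 0)"
    using power[of 1] by simp
  have carrier: "carrier ?G = {f. (\<forall>i. \<exists>x\<in>filt i. f i = filt (Suc i) +>\<^bsub>A\<^esub> x) \<and>
      finite {i. f i \<noteq> filt (Suc i)}}"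
    unfolding assoc_graded_def power by simp
  have coset0: "filt n +>\<^bsub>A\<^esub> \<zero>\<^bsub>A\<^esub> = filt n" for n
    using filt_ideal by (simp add: quotient_coset_eq_zero_iff filt_def)
  have closed: "?h x \<in> carrier ?G" if x: "x \<in> carrier A" for x
  proof -
    obtain N where N: "\<forall>n\<ge>N. part n x = \<zero>\<^bsub>A\<^esub>" using part_finite[OF x] by blast
    have "{i. ?h x i \<noteq> filt (Suc i)} \<subseteq> {..<N}"
      using N coset0 by (auto simp: not_less[symmetric])
    then have "finite {i. ?h x i \<noteq> filt (Suc i)}"
      by (rule finite_subset) simp
    then show ?thesis
      unfolding carrier using part_in_filt[OF x] by blast
  qed
  have mult: "?h (x \<otimes>\<^bsub>A\<^esub> y) = ?h x \<otimes>\<^bsub>?G\<^esub> ?h y" if xy: "x \<in> carrier A" "y \<in> carrier A" for x y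
  proof
    fix n
    let ?F = "filt (Suc n)"
    interpret F: ideal ?F A by (rule filt_ideal)
    interpret q: ring_hom_ring A "A Quot ?F" "(+>\<^bsub>A\<^esub>) ?F" by (rule F.rcos_ring_hom_ring)
    have "?h (x \<otimes>\<^bsub>A\<^esub> y) n = (\<Oplus>\<^bsub>A Quot ?F\<^esub>i\<in>{..n}. ?F +>\<^bsub>A\<^esub> (part i x \<otimes>\<^bsub>A\<^esub> part (n - i) y))"
      using xy q.hom_finsum[of "\<lambda>i. part i x \<otimes>\<^bsub>A\<^esub> part (n - i) y" "{..n}"]
      by (simp add: part_mult Pi_def comp_def del: q.hom_mult)
    also have "\<dots> = (\<Oplus>\<^bsub>A Quot ?F\<^esub>i\<in>{..n}. rcoset_mult A ?F (?h x i) (?h y (n - i)))"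
    proof (rule q.S.finsum_cong'[OF refl])
      fix i assume "i \<in> {..n}"
      then have *: "rcoset_mult A ?F (?h x i) (?h y (n - i)) = ?F +>\<^bsub>A\<^esub> (part i x \<otimes>\<^bsub>A\<^esub> part (n - i) y)"
        using rcoset_mult_filt[OF part_in_filt part_in_filt, of x y i "n - i"] xy by simp
      then show "?F +>\<^bsub>A\<^esub> (part i x \<otimes>\<^bsub>A\<^esub> part (n - i) y) = rcoset_mult A ?F (?h x i) (?h y (n - i))" ..
    next
      have "rcoset_mult A ?F (?h x i) (?h y (n - i)) \<in> carrier (A Quot ?F)" if "i \<in> {..n}" for i
        using rcoset_mult_filt[OF part_in_filt part_in_filt, of x y i "n - i"] xy that
        by (simp del: q.hom_mult)
      then show "(\<lambda>i. rcoset_mult A ?F (?h x i) (?h y (n - i))) \<in> {..n} \<rightarrow> carrier (A Quot ?F)"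
        by simp
    qed
    also have "\<dots> = (?h x \<otimes>\<^bsub>?G\<^esub> ?h y) n"
      unfolding assoc_graded_def power by simp
    finally show "?h (x \<otimes>\<^bsub>A\<^esub> y) n = (?h x \<otimes>\<^bsub>?G\<^esub> ?h y) n" .
  qed
  have add: "?h (x \<oplus>\<^bsub>A\<^esub> y) = ?h x \<oplus>\<^bsub>?G\<^esub> ?h y" if "x \<in> carrier A" "y \<in> carrier A" for x y
    using that ideal.a_rcos_sum[OF filt_ideal] by (simp add: assoc_graded_def part_add)
  have "part (Suc n) \<one>\<^bsub>A\<^esub> = \<zero>\<^bsub>A\<^esub>" for n
    using part_part[of "\<one>\<^bsub>A\<^esub>" "Suc n" 0] by (simp add: part_one)
  then have "?h \<one>\<^bsub>A\<^esub> n = (if n = 0 then filt (Suc 0) +>\<^bsub>A\<^esub> \<one>\<^bsub>A\<^esub> else filt (Suc n))" for n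
    using coset0 by (cases n) (simp_all add: part_one)
  then have one: "?h \<one>\<^bsub>A\<^esub> = \<one>\<^bsub>?G\<^esub>"
    unfolding assoc_graded_def power power1 by (simp add: fun_eq_iff)
  have hom: "?h \<in> ring_hom A ?G"
    using closed mult add one by (rule ring_hom_memI)
  have smult: "?h (c \<odot>\<^bsub>A\<^esub> x) = c \<odot>\<^bsub>?G\<^esub> ?h x" if "c \<in> carrier K" "x \<in> carrier A" for c x
  proof
    fix n
    interpret F: ideal "filt (Suc n)" A by (rule filt_ideal)
    have "coset_smult A (filt (Suc n)) c (filt (Suc n) +>\<^bsub>A\<^esub> part n x) =
        filt (Suc n) +>\<^bsub>A\<^esub> (c \<odot>\<^bsub>A\<^esub> part n x)"
      using that F.coset_map_coset[of "\<lambda>x. c \<odot>\<^bsub>A\<^esub> x" "part n x"]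
      by (simp add: coset_smult_eq_coset_map smult_r_distr ideal_smult_closed[OF filt_ideal])
    then show "?h (c \<odot>\<^bsub>A\<^esub> x) n = (c \<odot>\<^bsub>?G\<^esub> ?h x) n"
      using that unfolding assoc_graded_def power by (simp add: part_smult)
  qed
  have inj: "inj_on ?h (carrier A)"
  proof (rule inj_onI)
    fix x y assume xy: "x \<in> carrier A" "y \<in> carrier A" and eq: "?h x = ?h y"
    have "part n x = part n y" for n
    proof -
      have "part n x \<ominus>\<^bsub>A\<^esub> part n y \<in> filt (Suc n)"
        using fun_cong[OF eq, of n] xy quotient_coset_eq_iff[OF filt_ideal] by simp
      then have "part n (part n x \<ominus>\<^bsub>A\<^esub> part n y) = \<zero>\<^bsub>A\<^esub>"
        by (simp add: filt_def)
      then show ?thesis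
        using xy by (simp add: part_diff part_part)
    qed
    then show "x = y"
      using eq_iff_parts[OF xy] by blast
  qed
  have surj: "\<exists>x\<in>carrier A. f = ?h x" if f: "f \<in> carrier ?G" for f
  proof -
    have "\<forall>i. \<exists>x. x \<in> filt i \<and> f i = filt (Suc i) +>\<^bsub>A\<^esub> x"
      using f unfolding carrier by blast
    then obtain x where x: "\<And>i. x i \<in> filt i" "\<And>i. f i = filt (Suc i) +>\<^bsub>A\<^esub> x i"
      by metis
    let ?S = "{i. f i \<noteq> filt (Suc i)}"
    have S: "finite ?S" using f unfolding carrier by blast
    have carr: "x i \<in> carrier A" for i
      using x(1) by (rule filt_carrier)
    \<comment> \<open>\<open>x i\<close> may have components in degrees above \<open>i\<close>, so only its leading parts are summed up\<close>
    define y where "y = (\<Oplus>\<^bsub>A\<^esub>i\<in>?S. part i (x i))"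
    have y: "y \<in> carrier A" "\<And>n. part n y = (if n \<in> ?S then part n (x n) else \<zero>\<^bsub>A\<^esub>)"
      unfolding y_def using carr part_sum_parts[OF S, of x] by (simp_all add: Pi_def)
    have "f n = ?h y n" for n
    proof (cases "n \<in> ?S")
      case True
      have "filt (Suc n) +>\<^bsub>A\<^esub> x n = filt (Suc n) +>\<^bsub>A\<^esub> part n (x n)"
        using diff_part_in_filt[OF x(1)] carr quotient_coset_eq_iff[OF filt_ideal] by simp
      then show ?thesis
        using True by (simp add: y x(2)[symmetric])
    next
      case False
      then show ?thesis by (simp add: y coset0)
    qed
    with y(1) show ?thesis by blast
  qed
  have "bij_betw ?h (carrier A) (carrier ?G)"
    using inj closed surj by (auto simp: bij_betw_def)
  with hom smult show ?thesis
    by (simp add: algebra_iso_def ring_iso_def)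
qed

text \<open>The hypotheses concern the graded algebra \<open>A\<close> itself, where coefficients can be read off; each
  of them passes to the quotient by \<open>I\<close>.\<close>

theorem tightly_graded_quotient:
  assumes I: "ideal I A" and hom: "\<And>x n. x \<in> I \<Longrightarrow> part n x \<in> I"
    and nil: "filt N \<subseteq> I"
    and gen: "\<And>n. filt (Suc n) \<subseteq> filt n \<cdot>\<^bsub>A\<^esub> filt 1"
    and char: "\<And>\<chi>. \<chi> \<in> H \<Longrightarrow> ring_hom_ring A K \<chi>"
    and surj: "\<And>\<chi>. \<chi> \<in> H \<Longrightarrow> \<chi> ` carrier A = carrier K"
    and vanish: "\<And>\<chi> x. \<chi> \<in> H \<Longrightarrow> x \<in> I \<Longrightarrow> \<chi> x = \<zero>\<^bsub>K\<^esub>"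
    and ker: "\<And>x. x \<in> carrier A \<Longrightarrow> (\<And>\<chi>. \<chi> \<in> H \<Longrightarrow> \<chi> x = \<zero>\<^bsub>K\<^esub>) \<Longrightarrow> x \<in> filt 1"
    and fin: "vectorspace.fin_dim K (quotient_algebra A I)"
  shows "tightly_graded K (quotient_algebra A I)"
proof -
  let ?B = "quotient_algebra A I" and ?q = "\<lambda>x. I +>\<^bsub>A\<^esub> x"
  interpret I: ideal I A by fact
  interpret B: graded_algebra K ?B "\<lambda>n. coset_map A I (part n)"
    using I hom by (rule graded_quotient)
  interpret q: ring_hom_ring A ?B ?q using I by (rule quotient_ring_hom)
  have filt: "B.filt n = ?q ` filt n" for n
    using I hom by (rule filt_quotient)
  have carrier: "carrier ?B = ?q ` carrier A" by (rule carrier_quotient_algebra)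
  have genB: "B.filt (Suc n) \<subseteq> B.filt n \<cdot>\<^bsub>?B\<^esub> B.filt 1" for n
  proof -
    have "?q x \<in> ?q ` filt n \<cdot>\<^bsub>?B\<^esub> ?q ` filt 1" if "x \<in> filt n \<cdot>\<^bsub>A\<^esub> filt 1" for x
      using that
    proof induction
      case (prod i j)
      then have "?q (i \<otimes>\<^bsub>A\<^esub> j) = ?q i \<otimes>\<^bsub>?B\<^esub> ?q j"
        by (simp add: filt_carrier)
      with prod show ?case by (auto intro: ideal_prod.prod)
    next
      case (sum x y)
      have "x \<in> carrier A" "y \<in> carrier A"
        using sum A.ideal_prod_in_carrier[OF filt_ideal filt_ideal] by blast+
      then have "?q (x \<oplus>\<^bsub>A\<^esub> y) = ?q x \<oplus>\<^bsub>?B\<^esub> ?q y" by simp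
      with sum show ?case by (auto intro: ideal_prod.sum)
    qed
    with gen[of n] show ?thesis
      unfolding filt by blast
  qed
  have zero: "\<zero>\<^bsub>?B\<^esub> = I" using I by (rule quotient_zero)
  have "?q x = I" if "x \<in> filt N" for x
    using that nil quotient_coset_eq_zero_iff[OF I] filt_carrier by blast
  moreover have "\<zero>\<^bsub>A\<^esub> \<in> filt N" by (simp add: filt_def)
  ultimately have nilB: "B.filt N = {\<zero>\<^bsub>?B\<^esub>}"
    unfolding filt zero by blast
  \<comment> \<open>a homomorphism that vanishes on \<open>I\<close> is constant on each coset of \<open>I\<close>, and its lift to the
    quotient takes this value\<close>
  define lift where "lift \<chi> C = the_elem (\<chi> ` C)" for \<chi> :: "'c \<Rightarrow> 'a" and C
  have lift: "lift \<chi> (?q x) = \<chi> x" if \<chi>: "\<chi> \<in> H" and x: "x \<in> carrier A" for \<chi> x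
  proof -
    interpret \<chi>: ring_hom_ring A K \<chi> using \<chi> by (rule char)
    have "\<chi> y = \<chi> x" if "y \<in> ?q x" for y
      using that x \<chi> vanish[OF \<chi>] by (auto simp: a_r_coset_def' I.Icarr)
    then have "\<chi> ` ?q x = {\<chi> x}"
      using I.a_rcos_self[OF x] by blast
    then show ?thesis by (simp add: lift_def)
  qed
  have "jacobson_radical ?B = B.filt 1"
  proof (rule B.jacobson_radical_eq_filt_1[OF nilB, of "lift ` H"])
    fix \<psi> assume "\<psi> \<in> lift ` H"
    then obtain \<chi> where \<chi>: "\<chi> \<in> H" "\<psi> = lift \<chi>" by blast
    interpret \<chi>: ring_hom_ring A K \<chi> using \<chi>(1) by (rule char)
    have "\<psi> \<in> ring_hom ?B K"
      by (rule ring_hom_memI)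
        (auto simp: carrier \<chi> lift quotient_add[OF I] quotient_mult[OF I] quotient_one[OF I]
          simp del: q.hom_add q.hom_mult q.hom_one)
    then show "ring_hom_ring ?B K \<psi>"
      by (rule ring_hom_ringI2[OF B.A.ring_axioms R.ring_axioms])
    have "\<psi> ` carrier ?B = \<chi> ` carrier A"
      unfolding carrier image_image using \<chi> lift by auto
    then show "\<psi> ` carrier ?B = carrier K"
      using surj[OF \<chi>(1)] by simp
  next
    fix x assume "x \<in> carrier ?B" and x: "\<And>\<psi>. \<psi> \<in> lift ` H \<Longrightarrow> \<psi> x = \<zero>\<^bsub>K\<^esub>"
    then obtain y where y: "x = ?q y" "y \<in> carrier A" unfolding carrier by blast
    have "y \<in> filt 1"
    proof (rule ker[OF y(2)])
      show "\<chi> y = \<zero>\<^bsub>K\<^esub>" if "\<chi> \<in> H" for \<chi>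
        using x[of "lift \<chi>"] lift[OF that y(2)] that y by simp
    qed
    with y show "x \<in> B.filt 1" unfolding filt by blast
  qed
  then show ?thesis
    unfolding tightly_graded_def
    using B.assoc_algebra_axioms fin B.assoc_graded_iso[OF genB] by auto
qed

end

section \<open>Path algebras\<close>

lemma (in abelian_monoid) finsum_Sigma:
  assumes "finite A" "\<And>a. a \<in> A \<Longrightarrow> finite (B a)"
    and "\<And>a b. a \<in> A \<Longrightarrow> b \<in> B a \<Longrightarrow> F a b \<in> carrier G"
  shows "(\<Oplus>a\<in>A. \<Oplus>b\<in>B a. F a b) = (\<Oplus>t\<in>Sigma A B. F (fst t) (snd t))"
  using assms
proof (induction A rule: finite_induct)
  case (insert a A)
  have split: "Sigma (insert a A) B = Pair a ` B a \<union> Sigma A B" by auto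
  have "(\<Oplus>t\<in>Sigma (insert a A) B. F (fst t) (snd t)) =
      (\<Oplus>t\<in>Pair a ` B a. F (fst t) (snd t)) \<oplus> (\<Oplus>t\<in>Sigma A B. F (fst t) (snd t))"
    unfolding split using insert by (intro finsum_Un_disjoint) auto
  also have "(\<Oplus>t\<in>Pair a ` B a. F (fst t) (snd t)) = (\<Oplus>b\<in>B a. F a b)"
    using insert by (subst finsum_reindex) (auto simp: inj_on_def)
  also have "(\<Oplus>t\<in>Sigma A B. F (fst t) (snd t)) = (\<Oplus>a\<in>A. \<Oplus>b\<in>B a. F a b)"
    using insert by simp
  finally show ?case
    using insert by (simp add: finsum_insert Pi_def finsum_closed)
qed simp

locale finite_quiver = K: field K + fin_digraph Q
  for K :: "('k, 'm) ring_scheme" (structure) and Q :: "('v, 'e) pre_digraph" (structure)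
begin

abbreviation P :: "('k, ('v, 'e) path \<Rightarrow> 'k) module"
  where "P \<equiv> path_algebra K Q"

text \<open>The index set of the sum defining the coefficient of a product at \<open>(u, p, w)\<close>: the ways of
  cutting \<open>p\<close> into two composable walks.\<close>

definition splits :: "'v \<Rightarrow> 'e list \<Rightarrow> 'v \<Rightarrow> ('e list \<times> 'v \<times> 'e list) set"
  where "splits u p w = {(p1, v, p2). awalk u p1 v \<and> awalk v p2 w \<and> p1 @ p2 = p}"

lemma finite_splits: "finite (splits u p w)"
proof -
  have "splits u p w \<subseteq> (\<lambda>k. (take k p, awlast u (take k p), drop k p)) ` {..length p}"
  proof
    fix t assume "t \<in> splits u p w"
    then obtain p1 v p2 where t: "t = (p1, v, p2)" "awalk u p1 v" "p1 @ p2 = p"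
      by (auto simp: splits_def)
    then have "t = (take (length p1) p, awlast u (take (length p1) p), drop (length p1) p)"
      "length p1 \<le> length p"
      by auto
    then show "t \<in> (\<lambda>k. (take k p, awlast u (take k p), drop k p)) ` {..length p}" by blast
  qed
  then show ?thesis by (rule finite_subset) simp
qed

lemma splits_empty: "\<not> awalk u p w \<Longrightarrow> splits u p w = {}"
  by (auto simp: splits_def dest: awalk_appendI)

lemma carrier_P: "carrier P = {f. (\<forall>x. f x \<in> carrier K) \<and> finite {x. f x \<noteq> \<zero>\<^bsub>K\<^esub>} \<and>
    (\<forall>u p v. \<not> awalk u p v \<longrightarrow> f (u, p, v) = \<zero>\<^bsub>K\<^esub>)}"
  by (simp only: path_algebra_def partial_object.simps)

lemma path_algebra_memI:
  assumes "\<And>x. f x \<in> carrier K" "finite {x. f x \<noteq> \<zero>\<^bsub>K\<^esub>}"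
    and "\<And>u p v. \<not> awalk u p v \<Longrightarrow> f (u, p, v) = \<zero>\<^bsub>K\<^esub>"
  shows "f \<in> carrier P"
  using assms unfolding carrier_P by blast

lemma P_closed [simp]: "f \<in> carrier P \<Longrightarrow> f x \<in> carrier K"
  and P_finite_support: "f \<in> carrier P \<Longrightarrow> finite {x. f x \<noteq> \<zero>\<^bsub>K\<^esub>}"
  and P_not_walk: "\<lbrakk>f \<in> carrier P; \<not> awalk u p v\<rbrakk> \<Longrightarrow> f (u, p, v) = \<zero>\<^bsub>K\<^esub>"
  unfolding carrier_P by blast+

lemma mult_P: "(f \<otimes>\<^bsub>P\<^esub> g) (u, p, w) =
    (\<Oplus>\<^bsub>K\<^esub>t\<in>splits u p w. f (u, fst t, fst (snd t)) \<otimes>\<^bsub>K\<^esub> g (fst (snd t), snd (snd t), w))"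
  unfolding path_algebra_def splits_def
  by (simp only: monoid.simps prod.case) (simp only: case_prod_unfold)

lemma add_P: "f \<oplus>\<^bsub>P\<^esub> g = (\<lambda>x. f x \<oplus>\<^bsub>K\<^esub> g x)"
  and smult_P: "c \<odot>\<^bsub>P\<^esub> f = (\<lambda>x. c \<otimes>\<^bsub>K\<^esub> f x)"
  and zero_P: "\<zero>\<^bsub>P\<^esub> = (\<lambda>x. \<zero>\<^bsub>K\<^esub>)"
  and one_P: "\<one>\<^bsub>P\<^esub> = (\<lambda>(u, p, v). if u \<in> verts Q \<and> p = [] \<and> v = u then \<one>\<^bsub>K\<^esub> else \<zero>\<^bsub>K\<^esub>)"
  by (simp_all only: path_algebra_def monoid.simps ring.simps module.simps)

lemma P_ext: "(\<And>u p w. f (u, p, w) = g (u, p, w)) \<Longrightarrow> f = g"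
  by (rule ext) auto

lemma add_P_closed:
  assumes f: "f \<in> carrier P" and g: "g \<in> carrier P"
  shows "f \<oplus>\<^bsub>P\<^esub> g \<in> carrier P"
proof (rule path_algebra_memI)
  have "{x. (f \<oplus>\<^bsub>P\<^esub> g) x \<noteq> \<zero>\<^bsub>K\<^esub>} \<subseteq> {x. f x \<noteq> \<zero>\<^bsub>K\<^esub>} \<union> {x. g x \<noteq> \<zero>\<^bsub>K\<^esub>}"
    by (auto simp: add_P)
  then show "finite {x. (f \<oplus>\<^bsub>P\<^esub> g) x \<noteq> \<zero>\<^bsub>K\<^esub>}"
    by (rule finite_subset) (intro finite_UnI P_finite_support f g)
qed (use f g in \<open>simp_all add: add_P P_not_walk\<close>)

lemma smult_P_closed:
  assumes c: "c \<in> carrier K" and f: "f \<in> carrier P"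
  shows "c \<odot>\<^bsub>P\<^esub> f \<in> carrier P"
proof (rule path_algebra_memI)
  have "{x. (c \<odot>\<^bsub>P\<^esub> f) x \<noteq> \<zero>\<^bsub>K\<^esub>} \<subseteq> {x. f x \<noteq> \<zero>\<^bsub>K\<^esub>}"
    using c by (auto simp: smult_P)
  then show "finite {x. (c \<odot>\<^bsub>P\<^esub> f) x \<noteq> \<zero>\<^bsub>K\<^esub>}"
    by (rule finite_subset) (rule P_finite_support[OF f])
qed (use c f in \<open>simp_all add: smult_P P_not_walk\<close>)

lemma zero_P_closed: "\<zero>\<^bsub>P\<^esub> \<in> carrier P"
  by (rule path_algebra_memI) (simp_all add: zero_P)

lemma one_P_closed: "\<one>\<^bsub>P\<^esub> \<in> carrier P"
proof (rule path_algebra_memI)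
  have "{x. \<one>\<^bsub>P\<^esub> x \<noteq> \<zero>\<^bsub>K\<^esub>} \<subseteq> (\<lambda>u. (u, [], u)) ` verts Q"
    by (auto simp: one_P split: if_splits)
  then show "finite {x. \<one>\<^bsub>P\<^esub> x \<noteq> \<zero>\<^bsub>K\<^esub>}"
    by (rule finite_subset) simp
qed (auto simp: one_P awalk_Nil_iff)

lemma mult_P_closed: "\<lbrakk>f \<in> carrier P; g \<in> carrier P\<rbrakk> \<Longrightarrow> f \<otimes>\<^bsub>P\<^esub> g \<in> carrier P"
proof -
  assume f: "f \<in> carrier P" and g: "g \<in> carrier P"
  let ?S = "\<lambda>f. {x. f x \<noteq> \<zero>\<^bsub>K\<^esub>}" and ?c = "\<lambda>((u, p, v), (v', q, w)). (u, p @ q, w)"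
  have "?S (f \<otimes>\<^bsub>P\<^esub> g) \<subseteq> ?c ` (?S f \<times> ?S g)"
  proof
    fix x assume x: "x \<in> ?S (f \<otimes>\<^bsub>P\<^esub> g)"
    obtain u p w where upw: "x = (u, p, w)" by (cases x)
    have "\<exists>t\<in>splits u p w. f (u, fst t, fst (snd t)) \<otimes>\<^bsub>K\<^esub> g (fst (snd t), snd (snd t), w) \<noteq> \<zero>\<^bsub>K\<^esub>"
    proof (rule ccontr)
      assume "\<not> ?thesis"
      then have "(f \<otimes>\<^bsub>P\<^esub> g) (u, p, w) = (\<Oplus>\<^bsub>K\<^esub>t\<in>splits u p w. \<zero>\<^bsub>K\<^esub>)"
        unfolding mult_P by (intro K.finsum_cong') auto
      with x upw show False by (simp add: K.finsum_zero)
    qed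
    then obtain p1 v p2 where t: "(p1, v, p2) \<in> splits u p w"
      "f (u, p1, v) \<otimes>\<^bsub>K\<^esub> g (v, p2, w) \<noteq> \<zero>\<^bsub>K\<^esub>"
      by auto
    then have "f (u, p1, v) \<noteq> \<zero>\<^bsub>K\<^esub>" "g (v, p2, w) \<noteq> \<zero>\<^bsub>K\<^esub>"
      using f g by auto
    moreover have "x = ?c ((u, p1, v), (v, p2, w))"
      using t upw by (simp add: splits_def)
    ultimately show "x \<in> ?c ` (?S f \<times> ?S g)" by blast
  qed
  then have fin: "finite (?S (f \<otimes>\<^bsub>P\<^esub> g))"
    by (rule finite_subset) (intro finite_imageI finite_cartesian_product P_finite_support f g)
  have closed: "(f \<otimes>\<^bsub>P\<^esub> g) x \<in> carrier K" for x
    using f g by (cases x) (auto simp: mult_P intro!: K.finsum_closed)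
  have "(f \<otimes>\<^bsub>P\<^esub> g) (u, p, w) = \<zero>\<^bsub>K\<^esub>" if "\<not> awalk u p w" for u p w
    using splits_empty[OF that] by (simp add: mult_P)
  with closed fin show ?thesis by (rule path_algebra_memI)
qed

text \<open>Both sides are sums over the ways of cutting a walk into three pieces. On the left the second
  cut is made first, on the right the first one; \<open>finsum_Sigma\<close> merges the two nested sums, and
  the two index sets are in bijection.\<close>

lemma mult_P_assoc:
  assumes f: "f \<in> carrier P" and g: "g \<in> carrier P" and h: "h \<in> carrier P"
  shows "(f \<otimes>\<^bsub>P\<^esub> g) \<otimes>\<^bsub>P\<^esub> h = f \<otimes>\<^bsub>P\<^esub> (g \<otimes>\<^bsub>P\<^esub> h)"
proof (rule P_ext)
  fix u p w
  define F where "F p1 v p2 v' p3 = f (u, p1, v) \<otimes>\<^bsub>K\<^esub> g (v, p2, v') \<otimes>\<^bsub>K\<^esub> h (v', p3, w)" for p1 v p2 v' p3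
  have F: "F p1 v p2 v' p3 \<in> carrier K" for p1 v p2 v' p3
    using f g h by (simp add: F_def)
  let ?l = "Sigma (splits u p w) (\<lambda>s. splits u (fst s) (fst (snd s)))"
  let ?r = "Sigma (splits u p w) (\<lambda>s. splits (fst (snd s)) (snd (snd s)) w)"
  have "((f \<otimes>\<^bsub>P\<^esub> g) \<otimes>\<^bsub>P\<^esub> h) (u, p, w) = (\<Oplus>\<^bsub>K\<^esub>s\<in>splits u p w.
      \<Oplus>\<^bsub>K\<^esub>t\<in>splits u (fst s) (fst (snd s)).
        F (fst t) (fst (snd t)) (snd (snd t)) (fst (snd s)) (snd (snd s)))"
    unfolding mult_P[of "f \<otimes>\<^bsub>P\<^esub> g"]
    by (intro K.finsum_cong' refl)
      (use f g h in \<open>auto simp: mult_P F_def K.finsum_ldistr finite_splits Pi_def intro!: K.finsum_closed\<close>)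
  also have "\<dots> = (\<Oplus>\<^bsub>K\<^esub>st\<in>?l. F (fst (snd st)) (fst (snd (snd st))) (snd (snd (snd st)))
      (fst (snd (fst st))) (snd (snd (fst st))))"
    using F by (intro K.finsum_Sigma finite_splits) auto
  also have "\<dots> = (\<Oplus>\<^bsub>K\<^esub>st\<in>?r. F (fst (fst st)) (fst (snd (fst st))) (fst (snd st))
      (fst (snd (snd st))) (snd (snd (snd st))))"
    by (rule K.finsum_reindex_bij_witness[of _
          "\<lambda>((p1, v, q), (p2, v', p3)). ((p1 @ p2, v', p3), (p1, v, p2))"
          "\<lambda>((q, v', p3), (p1, v, p2)). ((p1, v, p2 @ p3), (p2, v', p3))"])
      (auto simp: splits_def F simp del: awalk_append_iff intro: awalk_appendI)
  also have "\<dots> = (\<Oplus>\<^bsub>K\<^esub>s\<in>splits u p w. \<Oplus>\<^bsub>K\<^esub>t\<in>splits (fst (snd s)) (snd (snd s)) w.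
        F (fst s) (fst (snd s)) (fst t) (fst (snd t)) (snd (snd t)))"
    using F by (intro K.finsum_Sigma[symmetric] finite_splits) auto
  also have "\<dots> = (f \<otimes>\<^bsub>P\<^esub> (g \<otimes>\<^bsub>P\<^esub> h)) (u, p, w)"
    unfolding mult_P[of f]
    by (intro K.finsum_cong' refl)
      (use f g h in \<open>auto simp: mult_P F_def K.finsum_rdistr finite_splits Pi_def K.m_assoc
        intro!: K.finsum_closed\<close>)
  finally show "((f \<otimes>\<^bsub>P\<^esub> g) \<otimes>\<^bsub>P\<^esub> h) (u, p, w) = (f \<otimes>\<^bsub>P\<^esub> (g \<otimes>\<^bsub>P\<^esub> h)) (u, p, w)" .
qed

lemma mult_P_cong_zero:
  assumes "\<And>p1 v p2. (p1, v, p2) \<in> splits u p w \<Longrightarrow> f (u, p1, v) \<otimes>\<^bsub>K\<^esub> g (v, p2, w) = \<zero>\<^bsub>K\<^esub>"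
  shows "(f \<otimes>\<^bsub>P\<^esub> g) (u, p, w) = \<zero>\<^bsub>K\<^esub>"
proof -
  have "(f \<otimes>\<^bsub>P\<^esub> g) (u, p, w) = (\<Oplus>\<^bsub>K\<^esub>t\<in>splits u p w. \<zero>\<^bsub>K\<^esub>)"
    unfolding mult_P using assms by (intro K.finsum_cong') auto
  then show ?thesis by (simp add: K.finsum_zero)
qed

text \<open>Evaluates a product at a walk for which a single cut contributes, as happens for products with
  the unit, products of two paths, and coefficients at trivial paths.\<close>

lemma mult_P_unique_split:
  assumes t: "(q1, x, q2) \<in> splits u p w" and f: "f (u, q1, x) \<otimes>\<^bsub>K\<^esub> g (x, q2, w) \<in> carrier K"
    and others: "\<And>p1 v p2. (p1, v, p2) \<in> splits u p w \<Longrightarrow> (p1, v, p2) \<noteq> (q1, x, q2) \<Longrightarrow>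
      f (u, p1, v) \<otimes>\<^bsub>K\<^esub> g (v, p2, w) = \<zero>\<^bsub>K\<^esub>"
  shows "(f \<otimes>\<^bsub>P\<^esub> g) (u, p, w) = f (u, q1, x) \<otimes>\<^bsub>K\<^esub> g (x, q2, w)"
proof -
  have "(f \<otimes>\<^bsub>P\<^esub> g) (u, p, w) =
      (\<Oplus>\<^bsub>K\<^esub>t\<in>splits u p w. if (q1, x, q2) = t then f (u, q1, x) \<otimes>\<^bsub>K\<^esub> g (x, q2, w) else \<zero>\<^bsub>K\<^esub>)"
    unfolding mult_P
  proof (rule K.finsum_cong'[OF refl])
    fix t assume "t \<in> splits u p w"
    then show "f (u, fst t, fst (snd t)) \<otimes>\<^bsub>K\<^esub> g (fst (snd t), snd (snd t), w) =
        (if (q1, x, q2) = t then f (u, q1, x) \<otimes>\<^bsub>K\<^esub> g (x, q2, w) else \<zero>\<^bsub>K\<^esub>)"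
      using others[of "fst t" "fst (snd t)" "snd (snd t)"]
      by (cases "t = (q1, x, q2)") auto
  qed (use f in auto)
  also have "\<dots> = f (u, q1, x) \<otimes>\<^bsub>K\<^esub> g (x, q2, w)"
    using K.finsum_singleton[OF t finite_splits, of "\<lambda>_. f (u, q1, x) \<otimes>\<^bsub>K\<^esub> g (x, q2, w)"] f by simp
  finally show ?thesis .
qed

lemma one_mult_P: "f \<in> carrier P \<Longrightarrow> \<one>\<^bsub>P\<^esub> \<otimes>\<^bsub>P\<^esub> f = f"
proof (rule P_ext)
  fix u p w assume f: "f \<in> carrier P"
  show "(\<one>\<^bsub>P\<^esub> \<otimes>\<^bsub>P\<^esub> f) (u, p, w) = f (u, p, w)"
  proof (cases "awalk u p w")
    case True
    then have u: "u \<in> verts Q" by (rule awalk_hd_in_verts)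
    have "(\<one>\<^bsub>P\<^esub> \<otimes>\<^bsub>P\<^esub> f) (u, p, w) = \<one>\<^bsub>P\<^esub> (u, [], u) \<otimes>\<^bsub>K\<^esub> f (u, p, w)"
      by (rule mult_P_unique_split) (use True u f in \<open>auto simp: splits_def one_P awalk_Nil_iff\<close>)
    then show ?thesis using u f by (simp add: one_P)
  next
    case False
    then show ?thesis using f by (simp add: mult_P splits_empty P_not_walk)
  qed
qed

lemma mult_one_P: "f \<in> carrier P \<Longrightarrow> f \<otimes>\<^bsub>P\<^esub> \<one>\<^bsub>P\<^esub> = f"
proof (rule P_ext)
  fix u p w assume f: "f \<in> carrier P"
  show "(f \<otimes>\<^bsub>P\<^esub> \<one>\<^bsub>P\<^esub>) (u, p, w) = f (u, p, w)"
  proof (cases "awalk u p w")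
    case True
    then have w: "w \<in> verts Q" by (rule awalk_last_in_verts)
    have "(f \<otimes>\<^bsub>P\<^esub> \<one>\<^bsub>P\<^esub>) (u, p, w) = f (u, p, w) \<otimes>\<^bsub>K\<^esub> \<one>\<^bsub>P\<^esub> (w, [], w)"
      by (rule mult_P_unique_split) (use True w f in \<open>auto simp: splits_def one_P awalk_Nil_iff\<close>)
    then show ?thesis using w f by (simp add: one_P)
  next
    case False
    then show ?thesis using f by (simp add: mult_P splits_empty P_not_walk)
  qed
qed

lemma mult_P_l_distr:
  assumes "f \<in> carrier P" "g \<in> carrier P" "h \<in> carrier P"
  shows "(f \<oplus>\<^bsub>P\<^esub> g) \<otimes>\<^bsub>P\<^esub> h = f \<otimes>\<^bsub>P\<^esub> h \<oplus>\<^bsub>P\<^esub> g \<otimes>\<^bsub>P\<^esub> h"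
proof (rule P_ext)
  fix u p w
  show "((f \<oplus>\<^bsub>P\<^esub> g) \<otimes>\<^bsub>P\<^esub> h) (u, p, w) = (f \<otimes>\<^bsub>P\<^esub> h \<oplus>\<^bsub>P\<^esub> g \<otimes>\<^bsub>P\<^esub> h) (u, p, w)"
    using assms by (simp add: mult_P add_P K.l_distr flip: K.finsum_addf)
qed

lemma mult_P_r_distr:
  assumes "f \<in> carrier P" "g \<in> carrier P" "h \<in> carrier P"
  shows "h \<otimes>\<^bsub>P\<^esub> (f \<oplus>\<^bsub>P\<^esub> g) = h \<otimes>\<^bsub>P\<^esub> f \<oplus>\<^bsub>P\<^esub> h \<otimes>\<^bsub>P\<^esub> g"
proof (rule P_ext)
  fix u p w
  show "(h \<otimes>\<^bsub>P\<^esub> (f \<oplus>\<^bsub>P\<^esub> g)) (u, p, w) = (h \<otimes>\<^bsub>P\<^esub> f \<oplus>\<^bsub>P\<^esub> h \<otimes>\<^bsub>P\<^esub> g) (u, p, w)"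
    using assms by (simp add: mult_P add_P K.r_distr flip: K.finsum_addf)
qed

lemma smult_mult_P:
  assumes "c \<in> carrier K" "f \<in> carrier P" "g \<in> carrier P"
  shows "(c \<odot>\<^bsub>P\<^esub> f) \<otimes>\<^bsub>P\<^esub> g = c \<odot>\<^bsub>P\<^esub> (f \<otimes>\<^bsub>P\<^esub> g)"
    and "f \<otimes>\<^bsub>P\<^esub> (c \<odot>\<^bsub>P\<^esub> g) = c \<odot>\<^bsub>P\<^esub> (f \<otimes>\<^bsub>P\<^esub> g)"
proof -
  show "(c \<odot>\<^bsub>P\<^esub> f) \<otimes>\<^bsub>P\<^esub> g = c \<odot>\<^bsub>P\<^esub> (f \<otimes>\<^bsub>P\<^esub> g)"
  proof (rule P_ext)
    fix u p w
    show "((c \<odot>\<^bsub>P\<^esub> f) \<otimes>\<^bsub>P\<^esub> g) (u, p, w) = (c \<odot>\<^bsub>P\<^esub> (f \<otimes>\<^bsub>P\<^esub> g)) (u, p, w)"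
      using assms by (simp add: mult_P smult_P K.finsum_rdistr finite_splits Pi_def K.m_assoc)
  qed
  show "f \<otimes>\<^bsub>P\<^esub> (c \<odot>\<^bsub>P\<^esub> g) = c \<odot>\<^bsub>P\<^esub> (f \<otimes>\<^bsub>P\<^esub> g)"
  proof (rule P_ext)
    fix u p w
    show "(f \<otimes>\<^bsub>P\<^esub> (c \<odot>\<^bsub>P\<^esub> g)) (u, p, w) = (c \<odot>\<^bsub>P\<^esub> (f \<otimes>\<^bsub>P\<^esub> g)) (u, p, w)"
      using assms by (simp add: mult_P smult_P K.finsum_rdistr finite_splits Pi_def K.m_lcomm)
  qed
qed

lemma abelian_group_P: "abelian_group P"
proof (rule abelian_groupI)
  fix f assume f: "f \<in> carrier P"
  have "(\<ominus>\<^bsub>K\<^esub> \<one>\<^bsub>K\<^esub>) \<odot>\<^bsub>P\<^esub> f \<in> carrier P"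
    using f by (intro smult_P_closed) simp_all
  moreover have "(\<ominus>\<^bsub>K\<^esub> \<one>\<^bsub>K\<^esub>) \<odot>\<^bsub>P\<^esub> f \<oplus>\<^bsub>P\<^esub> f = \<zero>\<^bsub>P\<^esub>"
    using f by (simp add: add_P smult_P zero_P K.l_minus K.l_neg)
  ultimately show "\<exists>g\<in>carrier P. g \<oplus>\<^bsub>P\<^esub> f = \<zero>\<^bsub>P\<^esub>" by blast
next
  show "f \<oplus>\<^bsub>P\<^esub> g = g \<oplus>\<^bsub>P\<^esub> f" if "f \<in> carrier P" "g \<in> carrier P" for f g
    unfolding add_P using that K.a_comm by fastforce
qed (simp_all add: add_P_closed zero_P_closed, simp_all add: add_P zero_P K.a_assoc)

lemma ring_P: "ring P"
  by (intro ringI abelian_group_P monoidI)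
    (simp_all add: mult_P_closed one_P_closed mult_P_assoc one_mult_P mult_one_P
      mult_P_l_distr mult_P_r_distr)

theorem assoc_algebra_P: "assoc_algebra K P"
proof -
  have "module K P"
    by (rule moduleI[OF K.cring_axioms abelian_group_P])
      (simp_all add: smult_P_closed, simp_all add: smult_P add_P K.l_distr K.r_distr K.m_assoc)
  then have "vectorspace K P"
    using K.field_axioms by (rule vectorspace.intro)
  moreover have "assoc_algebra_axioms K P"
    by (rule assoc_algebra_axioms.intro) (simp_all add: smult_mult_P)
  ultimately show ?thesis
    using ring_P by (intro assoc_algebra.intro)
qed

sublocale P: assoc_algebra K P
  by (rule assoc_algebra_P)

subsection \<open>The grading by length\<close>

definition length_part :: "nat \<Rightarrow> (('v, 'e) path \<Rightarrow> 'k) \<Rightarrow> ('v, 'e) path \<Rightarrow> 'k"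
  where "length_part n f = (\<lambda>(u, p, w). if length p = n then f (u, p, w) else \<zero>\<^bsub>K\<^esub>)"

lemma length_part_apply [simp]:
  "length_part n f (u, p, w) = (if length p = n then f (u, p, w) else \<zero>\<^bsub>K\<^esub>)"
  by (simp add: length_part_def)

lemma length_part_closed:
  assumes f: "f \<in> carrier P"
  shows "length_part n f \<in> carrier P"
proof (rule path_algebra_memI)
  have "{x. length_part n f x \<noteq> \<zero>\<^bsub>K\<^esub>} \<subseteq> {x. f x \<noteq> \<zero>\<^bsub>K\<^esub>}"
    by (auto simp: length_part_def split: if_splits)
  then show "finite {x. length_part n f x \<noteq> \<zero>\<^bsub>K\<^esub>}"
    by (rule finite_subset) (rule P_finite_support[OF f])
  show "length_part n f x \<in> carrier K" for x
    using f by (cases x) simp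
qed (use f in \<open>simp add: P_not_walk\<close>)

lemma finsum_P_apply:
  assumes "finite S" "\<And>i. i \<in> S \<Longrightarrow> F i \<in> carrier P"
  shows "(\<Oplus>\<^bsub>P\<^esub>i\<in>S. F i) x = (\<Oplus>\<^bsub>K\<^esub>i\<in>S. F i x)"
  using assms
proof (induction S rule: finite_induct)
  case empty
  then show ?case by (simp add: zero_P)
next
  case (insert i S)
  then have "(\<Oplus>\<^bsub>P\<^esub>i\<in>insert i S. F i) = F i \<oplus>\<^bsub>P\<^esub> (\<Oplus>\<^bsub>P\<^esub>i\<in>S. F i)"
    by (simp add: P.M.finsum_insert Pi_def)
  with insert show ?case
    by (simp add: add_P K.finsum_insert Pi_def)
qed

text \<open>A cut of a walk of length \<open>n\<close> has a first piece of exactly one length \<open>i \<le> n\<close>, and the second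
  piece then has length \<open>n - i\<close>. So after exchanging the two sums, the inner sum over \<open>i\<close> has one
  nonzero term.\<close>

lemma length_part_mult:
  assumes f: "f \<in> carrier P" and g: "g \<in> carrier P"
  shows "length_part n (f \<otimes>\<^bsub>P\<^esub> g) = (\<Oplus>\<^bsub>P\<^esub>i\<in>{..n}. length_part i f \<otimes>\<^bsub>P\<^esub> length_part (n - i) g)"
proof (rule P_ext)
  fix u p w
  let ?t = "\<lambda>t. f (u, fst t, fst (snd t)) \<otimes>\<^bsub>K\<^esub> g (fst (snd t), snd (snd t), w)"
  let ?ti = "\<lambda>i t. length_part i f (u, fst t, fst (snd t)) \<otimes>\<^bsub>K\<^esub>
    length_part (n - i) g (fst (snd t), snd (snd t), w)"
  have sum: "(\<Oplus>\<^bsub>K\<^esub>i\<in>{..n}. ?ti i t) = (if length p = n then ?t t else \<zero>\<^bsub>K\<^esub>)"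
    if t: "t \<in> splits u p w" for t
  proof -
    have len: "length (fst t) + length (snd (snd t)) = length p"
      using t by (auto simp: splits_def)
    have "?ti i t = (if length (fst t) = i then if length p = n then ?t t else \<zero>\<^bsub>K\<^esub> else \<zero>\<^bsub>K\<^esub>)"
      if "i \<le> n" for i
      using that len f g by auto
    then have "(\<Oplus>\<^bsub>K\<^esub>i\<in>{..n}. ?ti i t) = (\<Oplus>\<^bsub>K\<^esub>i\<in>{..n}.
        if length (fst t) = i then if length p = n then ?t t else \<zero>\<^bsub>K\<^esub> else \<zero>\<^bsub>K\<^esub>)"
      using f g by (intro K.finsum_cong') auto
    also have "\<dots> = (if length p = n then ?t t else \<zero>\<^bsub>K\<^esub>)"
    proof (cases "length p = n")
      case True
      then have "length (fst t) \<in> {..n}" using len by simp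
      then show ?thesis
        using True f g K.finsum_singleton[of "length (fst t)" "{..n}" "\<lambda>_. ?t t"] by simp
    next
      case False
      then show ?thesis by (simp add: K.finsum_zero)
    qed
    finally show ?thesis .
  qed
  have "(\<Oplus>\<^bsub>P\<^esub>i\<in>{..n}. length_part i f \<otimes>\<^bsub>P\<^esub> length_part (n - i) g) (u, p, w) =
      (\<Oplus>\<^bsub>K\<^esub>i\<in>{..n}. \<Oplus>\<^bsub>K\<^esub>t\<in>splits u p w. ?ti i t)"
    using f g by (subst finsum_P_apply) (simp_all add: mult_P_closed length_part_closed mult_P)
  also have "\<dots> = (\<Oplus>\<^bsub>K\<^esub>t\<in>splits u p w. \<Oplus>\<^bsub>K\<^esub>i\<in>{..n}. ?ti i t)"
    using f g by (intro K.finsum_finsum_swap finite_splits) auto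
  also have "\<dots> = (\<Oplus>\<^bsub>K\<^esub>t\<in>splits u p w. if length p = n then ?t t else \<zero>\<^bsub>K\<^esub>)"
    using f g sum by (intro K.finsum_cong') auto
  also have "\<dots> = length_part n (f \<otimes>\<^bsub>P\<^esub> g) (u, p, w)"
    by (simp add: mult_P K.finsum_zero)
  finally show "length_part n (f \<otimes>\<^bsub>P\<^esub> g) (u, p, w) =
      (\<Oplus>\<^bsub>P\<^esub>i\<in>{..n}. length_part i f \<otimes>\<^bsub>P\<^esub> length_part (n - i) g) (u, p, w)" ..
qed

theorem graded_algebra_P: "graded_algebra K P length_part"
proof (rule graded_algebra.intro[OF assoc_algebra_P])
  show "graded_algebra_axioms K P length_part"
  proof
    fix f assume f: "f \<in> carrier P"
    then show "length_part n f \<in> carrier P" for n by (rule length_part_closed)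
    show "length_part n (c \<odot>\<^bsub>P\<^esub> f) = c \<odot>\<^bsub>P\<^esub> length_part n f" if "c \<in> carrier K" for c n
      using that by (auto simp: smult_P length_part_def)
    show "length_part m (length_part n f) = (if m = n then length_part n f else \<zero>\<^bsub>P\<^esub>)" for m n
      by (auto simp: length_part_def zero_P)
    have "finite ((\<lambda>(u, p, w). length p) ` {x. f x \<noteq> \<zero>\<^bsub>K\<^esub>})"
      using P_finite_support[OF f] by (rule finite_imageI)
    then obtain N where N: "\<And>x. f x \<noteq> \<zero>\<^bsub>K\<^esub> \<Longrightarrow> (\<lambda>(u, p, w). length p) x < N"
      unfolding finite_nat_set_iff_bounded by blast
    have "length_part n f = \<zero>\<^bsub>P\<^esub>" if "n \<ge> N" for n
      by (rule P_ext) (use N that in \<open>fastforce simp: zero_P\<close>)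
    then show "\<exists>N. \<forall>n\<ge>N. length_part n f = \<zero>\<^bsub>P\<^esub>" by blast
    show "f = \<zero>\<^bsub>P\<^esub>" if zero: "\<And>n. length_part n f = \<zero>\<^bsub>P\<^esub>"
    proof (rule P_ext)
      fix u p w
      have "length_part (length p) f (u, p, w) = \<zero>\<^bsub>P\<^esub> (u, p, w)" by (simp only: zero)
      then show "f (u, p, w) = \<zero>\<^bsub>P\<^esub> (u, p, w)" by simp
    qed
    fix g assume g: "g \<in> carrier P"
    show "length_part n (f \<oplus>\<^bsub>P\<^esub> g) = length_part n f \<oplus>\<^bsub>P\<^esub> length_part n g" for n
      by (auto simp: add_P length_part_def)
    show "length_part n (f \<otimes>\<^bsub>P\<^esub> g) =
        (\<Oplus>\<^bsub>P\<^esub>i\<in>{..n}. length_part i f \<otimes>\<^bsub>P\<^esub> length_part (n - i) g)" for n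
      using f g by (rule length_part_mult)
  next
    show "length_part 0 \<one>\<^bsub>P\<^esub> = \<one>\<^bsub>P\<^esub>"
      by (auto simp: length_part_def one_P)
  qed
qed

sublocale P: graded_algebra K P length_part
  by (rule graded_algebra_P)

subsection \<open>Paths as basis elements\<close>

definition path_elem :: "('v, 'e) path \<Rightarrow> ('v, 'e) path \<Rightarrow> 'k"
  where "path_elem x = (\<lambda>y. if y = x then \<one>\<^bsub>K\<^esub> else \<zero>\<^bsub>K\<^esub>)"

lemma path_elem_closed: "awalk u p v \<Longrightarrow> path_elem (u, p, v) \<in> carrier P"
  by (rule path_algebra_memI) (auto simp: path_elem_def)

lemma path_elem_mult:
  assumes p: "awalk u p v" and q: "awalk v q w"
  shows "path_elem (u, p, v) \<otimes>\<^bsub>P\<^esub> path_elem (v, q, w) = path_elem (u, p @ q, w)"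
proof (rule P_ext)
  fix a s b
  let ?f = "path_elem (u, p, v)" and ?g = "path_elem (v, q, w)"
  show "(?f \<otimes>\<^bsub>P\<^esub> ?g) (a, s, b) = path_elem (u, p @ q, w) (a, s, b)"
  proof (cases "(a, s, b) = (u, p @ q, w)")
    case True
    have "(?f \<otimes>\<^bsub>P\<^esub> ?g) (u, p @ q, w) = ?f (u, p, v) \<otimes>\<^bsub>K\<^esub> ?g (v, q, w)"
      by (rule mult_P_unique_split) (use p q in \<open>auto simp: splits_def path_elem_def\<close>)
    with True show ?thesis by (simp add: path_elem_def)
  next
    case False
    have "(?f \<otimes>\<^bsub>P\<^esub> ?g) (a, s, b) = \<zero>\<^bsub>K\<^esub>"
      by (rule mult_P_cong_zero) (use False in \<open>auto simp: splits_def path_elem_def\<close>)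
    with False show ?thesis by (simp add: path_elem_def)
  qed
qed

lemma path_elem_mult3:
  assumes "awalk u s x" "awalk x p y" "awalk y t w"
  shows "path_elem (u, s @ p @ t, w) =
    path_elem (u, s, x) \<otimes>\<^bsub>P\<^esub> path_elem (x, p, y) \<otimes>\<^bsub>P\<^esub> path_elem (y, t, w)"
  using assms awalk_appendI[OF assms(1,2)] by (simp add: path_elem_mult)

text \<open>The exponent has to be positive: the zeroth power is the sum of all trivial paths, not the
  trivial path at \<open>u\<close>.\<close>

lemma path_elem_pow:
  assumes "awalk u p u" "n > 0"
  shows "path_elem (u, p, u) [^]\<^bsub>P\<^esub> n = path_elem (u, concat (replicate n p), u)
    \<and> awalk u (concat (replicate n p)) u"
  using assms(2)
proof (induction n rule: nat_induct_non_zero)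
  case 1
  then show ?case using assms(1) by (simp add: path_elem_closed)
next
  case (Suc n)
  have "concat (replicate (Suc n) p) = concat (replicate n p) @ p"
    by (simp only: replicate_append_same[symmetric] replicate_Suc concat_append) simp
  moreover have "awalk u (concat (replicate n p) @ p) u"
    using Suc assms(1) by (blast intro: awalk_appendI)
  ultimately show ?case
    using Suc assms(1) path_elem_mult[of u "concat (replicate n p)" u p u] by simp
qed

lemma length_part_path_elem:
  "length_part n (path_elem (u, p, v)) = (if length p = n then path_elem (u, p, v) else \<zero>\<^bsub>P\<^esub>)"
  by (auto simp: length_part_def path_elem_def zero_P)

lemma awalk_factor:
  assumes walk: "awalk u (s @ q @ t) w" and q: "awalk x q y" "q \<noteq> []"
  shows "awalk u s x" "awalk y t w"
proof -
  obtain z z' where *: "awalk u s z" "awalk z q z'" "awalk z' t w"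
    using walk by auto
  with awalk_ends[OF q(1) *(2)] q(2) show "awalk u s x" "awalk y t w"
    by auto
qed

text \<open>Paths form a basis of the path algebra. The last case is restricted to paths in the support of
  \<open>f\<close>, which allows the induction to exploit lower bounds on their length.\<close>

lemma path_elem_induct:
  assumes f: "f \<in> carrier P"
    and zero: "S \<zero>\<^bsub>P\<^esub>"
    and add: "\<And>g h. \<lbrakk>g \<in> carrier P; h \<in> carrier P; S g; S h\<rbrakk> \<Longrightarrow> S (g \<oplus>\<^bsub>P\<^esub> h)"
    and path: "\<And>c u p v. \<lbrakk>c \<in> carrier K; awalk u p v; f (u, p, v) \<noteq> \<zero>\<^bsub>K\<^esub>\<rbrakk> \<Longrightarrow>
      S (c \<odot>\<^bsub>P\<^esub> path_elem (u, p, v))"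
  shows "S f"
proof -
  \<comment> \<open>the part of \<open>f\<close> supported on \<open>T\<close>; the induction adds the support of \<open>f\<close> path by path\<close>
  define r where "r T = (\<lambda>x. if x \<in> T then f x else \<zero>\<^bsub>K\<^esub>)" for T
  have r: "r T \<in> carrier P" for T
  proof (rule path_algebra_memI)
    have "{x. r T x \<noteq> \<zero>\<^bsub>K\<^esub>} \<subseteq> {x. f x \<noteq> \<zero>\<^bsub>K\<^esub>}" by (auto simp: r_def)
    then show "finite {x. r T x \<noteq> \<zero>\<^bsub>K\<^esub>}"
      by (rule finite_subset) (rule P_finite_support[OF f])
  qed (use f in \<open>simp_all add: r_def P_not_walk\<close>)
  have "S (r T)" if "finite T" "T \<subseteq> {x. f x \<noteq> \<zero>\<^bsub>K\<^esub>}" for T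
    using that
  proof (induction T rule: finite_induct)
    case empty
    have "r {} = \<zero>\<^bsub>P\<^esub>" by (simp add: r_def zero_P)
    with zero show ?case by simp
  next
    case (insert x T)
    obtain u p v where x: "x = (u, p, v)" by (cases x)
    have fx: "f (u, p, v) \<noteq> \<zero>\<^bsub>K\<^esub>" using insert x by simp
    then have walk: "awalk u p v" using P_not_walk[OF f] by blast
    have "r (insert x T) = f x \<odot>\<^bsub>P\<^esub> path_elem (u, p, v) \<oplus>\<^bsub>P\<^esub> r T"
      using f insert(2) x by (auto simp: r_def path_elem_def add_P smult_P)
    moreover have "S (f x \<odot>\<^bsub>P\<^esub> path_elem (u, p, v))"
      using f walk fx by (intro path) simp_all
    ultimately show ?case
      using insert f walk by (simp add: add smult_P_closed path_elem_closed r)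
  qed
  moreover have "r {x. f x \<noteq> \<zero>\<^bsub>K\<^esub>} = f"
    by (auto simp: r_def)
  ultimately show ?thesis
    using P_finite_support[OF f] by (metis order_refl)
qed

lemma path_elem_in_filt:
  assumes "awalk u p v" "n \<le> length p"
  shows "path_elem (u, p, v) \<in> P.filt n"
  using assms path_elem_closed[of u p v] unfolding P.filt_def
  by (auto simp: length_part_def path_elem_def zero_P)

lemma filt_coeff: "\<lbrakk>f \<in> P.filt n; length p < n\<rbrakk> \<Longrightarrow> f (u, p, v) = \<zero>\<^bsub>K\<^esub>"
proof -
  assume f: "f \<in> P.filt n" and len: "length p < n"
  have "length_part (length p) f (u, p, v) = \<zero>\<^bsub>P\<^esub> (u, p, v)"
    using f len by (simp only: P.filt_def mem_Collect_eq)
  then show ?thesis by (simp add: zero_P)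
qed

lemma filt_subset_ideal:
  assumes I: "ideal I P" and long: "\<And>u p v. awalk u p v \<Longrightarrow> N \<le> length p \<Longrightarrow> path_elem (u, p, v) \<in> I"
  shows "P.filt N \<subseteq> I"
proof
  fix f assume f: "f \<in> P.filt N"
  interpret I: ideal I P by fact
  have "f \<in> carrier P" using f by (rule P.filt_carrier)
  then show "f \<in> I"
  proof (rule path_elem_induct)
    fix c u p v assume "c \<in> carrier K" "awalk u p v" and fp: "f (u, p, v) \<noteq> \<zero>\<^bsub>K\<^esub>"
    moreover have "N \<le> length p"
      using fp filt_coeff[OF f] by (meson not_less)
    ultimately show "c \<odot>\<^bsub>P\<^esub> path_elem (u, p, v) \<in> I"
      using long P.ideal_smult_closed[OF I] by blast
  qed simp_all
qed

text \<open>A path of length greater than \<open>n\<close> is the product of its first \<open>n\<close> arrows, which lie in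
  \<open>F\<^sup>n\<close>, and of a nontrivial rest, which lies in \<open>F\<^sup>1\<close>.\<close>

lemma filt_Suc_subset_ideal_prod: "P.filt (Suc n) \<subseteq> P.filt n \<cdot>\<^bsub>P\<^esub> P.filt 1"
proof
  fix f assume f: "f \<in> P.filt (Suc n)"
  then have "f \<in> carrier P" by (rule P.filt_carrier)
  then show "f \<in> P.filt n \<cdot>\<^bsub>P\<^esub> P.filt 1"
  proof (rule path_elem_induct)
    have "\<zero>\<^bsub>P\<^esub> \<in> P.filt m" for m by (simp add: P.filt_def P.M.zero_closed)
    then have "\<zero>\<^bsub>P\<^esub> \<otimes>\<^bsub>P\<^esub> \<zero>\<^bsub>P\<^esub> \<in> P.filt n \<cdot>\<^bsub>P\<^esub> P.filt 1" by (intro ideal_prod.prod)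
    then show "\<zero>\<^bsub>P\<^esub> \<in> P.filt n \<cdot>\<^bsub>P\<^esub> P.filt 1" by simp
  next
    fix c u p v assume c: "c \<in> carrier K" and walk: "awalk u p v" and fp: "f (u, p, v) \<noteq> \<zero>\<^bsub>K\<^esub>"
    have len: "Suc n \<le> length p"
      using fp filt_coeff[OF f] by (meson not_less)
    let ?p1 = "take n p" and ?p2 = "drop n p"
    let ?x = "awlast u ?p1"
    have walks: "awalk u ?p1 ?x" "awalk ?x ?p2 v"
      using walk awalk_append_iff[of u ?p1 ?p2 v] by simp_all
    have "c \<odot>\<^bsub>P\<^esub> path_elem (u, p, v) = (c \<odot>\<^bsub>P\<^esub> path_elem (u, ?p1, ?x)) \<otimes>\<^bsub>P\<^esub> path_elem (?x, ?p2, v)"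
      using c walks by (simp add: P.smult_mult_left path_elem_closed path_elem_mult)
    moreover have "c \<odot>\<^bsub>P\<^esub> path_elem (u, ?p1, ?x) \<in> P.filt n"
      using walks len c by (intro P.ideal_smult_closed P.filt_ideal path_elem_in_filt) simp_all
    moreover have "path_elem (?x, ?p2, v) \<in> P.filt 1"
      using walks len by (intro path_elem_in_filt) simp_all
    ultimately show "c \<odot>\<^bsub>P\<^esub> path_elem (u, p, v) \<in> P.filt n \<cdot>\<^bsub>P\<^esub> P.filt 1"
      by (simp add: ideal_prod.prod)
  qed (rule ideal_prod.sum)
qed

subsection \<open>Vertex characters\<close>

text \<open>The coefficient at a trivial path is multiplicative since the trivial path can only be cut into
  trivial paths. This is the action on the simple module at the vertex \<open>v\<close>.\<close>

definition vertex_char :: "'v \<Rightarrow> (('v, 'e) path \<Rightarrow> 'k) \<Rightarrow> 'k"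
  where "vertex_char v f = f (v, [], v)"

lemma vertex_char_hom:
  assumes v: "v \<in> verts Q"
  shows "ring_hom_ring P K (vertex_char v)"
proof (rule ring_hom_ringI2[OF ring_P K.ring_axioms ring_hom_memI])
  fix f g assume f: "f \<in> carrier P" and g: "g \<in> carrier P"
  show "vertex_char v (f \<otimes>\<^bsub>P\<^esub> g) = vertex_char v f \<otimes>\<^bsub>K\<^esub> vertex_char v g"
    unfolding vertex_char_def
    by (rule mult_P_unique_split) (use v f g in \<open>auto simp: splits_def awalk_Nil_iff\<close>)
qed (use v in \<open>simp_all add: vertex_char_def add_P one_P\<close>)

lemma vertex_char_surj:
  assumes v: "v \<in> verts Q"
  shows "vertex_char v ` carrier P = carrier K"
proof (intro equalityI subsetI)
  fix c assume c: "c \<in> carrier K"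
  have "c \<odot>\<^bsub>P\<^esub> path_elem (v, [], v) \<in> carrier P"
    using c v by (intro smult_P_closed path_elem_closed) (simp_all add: awalk_Nil_iff)
  moreover have "vertex_char v (c \<odot>\<^bsub>P\<^esub> path_elem (v, [], v)) = c"
    using c by (simp add: vertex_char_def smult_P path_elem_def)
  ultimately show "c \<in> vertex_char v ` carrier P" by (metis imageI)
qed (auto simp: vertex_char_def)

lemma vertex_char_ker:
  assumes f: "f \<in> carrier P" and zero: "\<And>v. v \<in> verts Q \<Longrightarrow> vertex_char v f = \<zero>\<^bsub>K\<^esub>"
  shows "f \<in> P.filt 1"
proof -
  have "length_part 0 f = \<zero>\<^bsub>P\<^esub>"
  proof (rule P_ext)
    fix u p w
    have "f (u, [], w) = \<zero>\<^bsub>K\<^esub>"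
    proof (cases "awalk u [] w")
      case True
      then show ?thesis using zero[of u] by (auto simp: awalk_Nil_iff vertex_char_def)
    next
      case False
      then show ?thesis by (rule P_not_walk[OF f])
    qed
    then show "length_part 0 f (u, p, w) = \<zero>\<^bsub>P\<^esub> (u, p, w)" by (simp add: zero_P)
  qed
  with f show ?thesis by (simp add: P.filt_def)
qed

lemma filt_1_vertex_char: "f \<in> P.filt 1 \<Longrightarrow> vertex_char v f = \<zero>\<^bsub>K\<^esub>"
  using filt_coeff[of f 1 "[]" v v] by (simp add: vertex_char_def)

subsection \<open>Quotients by homogeneous relations\<close>

lemma finite_bounded_walks: "finite {(u, p, v). awalk u p v \<and> length p < N}"
proof -
  have "u \<in> verts Q \<and> set p \<subseteq> arcs Q \<and> v \<in> verts Q" if "awalk u p v" for u p v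
    using awalk_hd_in_verts[OF that] awalk_last_in_verts[OF that] that
    unfolding awalk_def by blast
  then have "{(u, p, v). awalk u p v \<and> length p < N} \<subseteq>
      verts Q \<times> {p. set p \<subseteq> arcs Q \<and> length p \<le> N} \<times> verts Q"
    by fastforce
  then show ?thesis
    by (rule finite_subset) (intro finite_cartesian_product finite_lists_length_le, simp_all)
qed

text \<open>Modulo \<open>I\<close> only the paths of length less than \<open>N\<close> survive, and a finite quiver has finitely many
  of them.\<close>

lemma fin_dim_quotient:
  assumes I: "ideal I P" and long: "\<And>u p v. awalk u p v \<Longrightarrow> N \<le> length p \<Longrightarrow> path_elem (u, p, v) \<in> I"
  shows "vectorspace.fin_dim K (quotient_algebra P I)"
proof -
  let ?B = "quotient_algebra P I" and ?q = "\<lambda>x. I +>\<^bsub>P\<^esub> x"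
  interpret B: assoc_algebra K ?B using I by (rule P.assoc_algebra_quotient)
  interpret I: ideal I P by fact
  let ?W = "(\<lambda>x. ?q (path_elem x)) ` {(u, p, v). awalk u p v \<and> length p < N}"
  have carrier: "carrier ?B = ?q ` carrier P" by (rule carrier_quotient_algebra)
  have W: "finite ?W" "?W \<subseteq> carrier ?B"
    using finite_bounded_walks[of N] path_elem_closed by (auto simp: carrier)
  interpret span: LinearCombinations.submodule K "B.span ?W" ?B
    using W(2) by (rule B.span_is_submodule)
  have "?q f \<in> B.span ?W" if f: "f \<in> carrier P" for f
    using f
  proof (rule path_elem_induct)
    show "?q \<zero>\<^bsub>P\<^esub> \<in> B.span ?W"
      unfolding P.quotient_coset_eq_zero_iff[OF I P.M.zero_closed, THEN iffD2, OF I.zero_closed]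
      using span.zero_closed unfolding P.quotient_zero[OF I] .
  next
    fix g h assume gh: "g \<in> carrier P" "h \<in> carrier P" and "?q g \<in> B.span ?W" "?q h \<in> B.span ?W"
    then have "?q g \<oplus>\<^bsub>?B\<^esub> ?q h \<in> B.span ?W" by (intro span.m_closed)
    then show "?q (g \<oplus>\<^bsub>P\<^esub> h) \<in> B.span ?W"
      unfolding P.quotient_add[OF I gh] .
  next
    fix c u p v assume c: "c \<in> carrier K" and walk: "awalk u p v"
    have "?q (path_elem (u, p, v)) \<in> B.span ?W"
    proof (cases "length p < N")
      case True
      then have "?q (path_elem (u, p, v)) \<in> ?W"
        using walk by blast
      then show ?thesis using B.in_own_span[OF W(2)] by blast
    next
      case False
      then have "?q (path_elem (u, p, v)) = \<zero>\<^bsub>?B\<^esub>"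
        using long[OF walk] P.quotient_zero[OF I] P.quotient_coset_eq_zero_iff[OF I path_elem_closed[OF walk]]
        by simp
      then show ?thesis using span.zero_closed by simp
    qed
    from span.smult_closed[OF c this]
    show "?q (c \<odot>\<^bsub>P\<^esub> path_elem (u, p, v)) \<in> B.span ?W"
      unfolding P.quotient_smult[OF I c path_elem_closed[OF walk]] .
  qed
  then have "carrier ?B \<subseteq> B.span ?W"
    unfolding carrier by (rule image_subsetI)
  with B.span_is_subset2[OF W(2)] have "B.span ?W = carrier ?B"
    by (rule subset_antisym)
  with W show ?thesis
    unfolding B.fin_dim_def by (intro exI[of _ ?W] conjI)
qed

theorem tightly_graded_path_algebra_quotient:
  assumes S: "S \<subseteq> P.filt 1" and hom: "\<And>s n. s \<in> S \<Longrightarrow> length_part n s \<in> genideal P S"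
    and long: "\<And>u p v. awalk u p v \<Longrightarrow> N \<le> length p \<Longrightarrow> path_elem (u, p, v) \<in> genideal P S"
  shows "tightly_graded K (quotient_algebra P (genideal P S))"
proof -
  have carr: "S \<subseteq> carrier P" using S by (auto dest: P.filt_carrier)
  have I: "ideal (genideal P S) P" using carr by (rule P.A.genideal_ideal)
  have le: "genideal P S \<subseteq> P.filt 1"
    using P.filt_ideal S by (rule P.A.genideal_minimal)
  show ?thesis
  proof (rule P.tightly_graded_quotient[OF I, of N "vertex_char ` verts Q"])
    show "length_part n x \<in> genideal P S" if "x \<in> genideal P S" for x n
      using carr hom that by (rule P.homogeneous_genideal)
    show "P.filt N \<subseteq> genideal P S"
      using I long by (rule filt_subset_ideal)
    show "P.filt (Suc n) \<subseteq> P.filt n \<cdot>\<^bsub>P\<^esub> P.filt 1" for n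
      by (rule filt_Suc_subset_ideal_prod)
    show "vectorspace.fin_dim K (quotient_algebra P (genideal P S))"
      using I long by (rule fin_dim_quotient)
    show "x \<in> P.filt 1" if "x \<in> carrier P" "\<And>\<chi>. \<chi> \<in> vertex_char ` verts Q \<Longrightarrow> \<chi> x = \<zero>\<^bsub>K\<^esub>" for x
      using that by (intro vertex_char_ker) auto
    fix \<chi> assume "\<chi> \<in> vertex_char ` verts Q"
    then obtain v where v: "v \<in> verts Q" "\<chi> = vertex_char v" by blast
    show "ring_hom_ring P K \<chi>"
      unfolding v(2) using v(1) by (rule vertex_char_hom)
    show "\<chi> ` carrier P = carrier K"
      unfolding v(2) using v(1) by (rule vertex_char_surj)
    show "\<chi> x = \<zero>\<^bsub>K\<^esub>" if "x \<in> genideal P S" for x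
      unfolding v(2) using subsetD[OF le that] by (rule filt_1_vertex_char)
  qed
qed

end

section \<open>The algebras \<open>A\<^sub>r\<close>\<close>

lemma quiver_simps [simp]:
  "verts quiver = {1, 2, 3}" "arcs quiver = UNIV"
  "tail quiver a\<^sub>1 = 1" "tail quiver a\<^sub>2 = 2" "tail quiver b\<^sub>1 = 1" "tail quiver b\<^sub>2 = 3"
  "head quiver a\<^sub>1 = 2" "head quiver a\<^sub>2 = 1" "head quiver b\<^sub>1 = 3" "head quiver b\<^sub>2 = 1"
proof -
  have "e \<in> {a\<^sub>1, a\<^sub>2, b\<^sub>1, b\<^sub>2}" for e by (cases e) simp_all
  then show "arcs quiver = UNIV" by (auto simp: quiver_def)
qed (simp_all add: quiver_def)

lemma fin_digraph_quiver: "fin_digraph quiver"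
proof
  show "tail quiver e \<in> verts quiver" "head quiver e \<in> verts quiver" for e
    by (cases e; simp)+
  show "finite (arcs quiver)" by (simp add: quiver_def del: quiver_simps)
qed simp

text \<open>The only arrow by which a walk can continue without completing \<open>a\<^sub>2 a\<^sub>1\<close> or \<open>b\<^sub>2 b\<^sub>1\<close>.\<close>

fun next_arrow :: "arrow \<Rightarrow> arrow"
  where
    "next_arrow a\<^sub>1 = a\<^sub>2"
  | "next_arrow a\<^sub>2 = b\<^sub>1"
  | "next_arrow b\<^sub>1 = b\<^sub>2"
  | "next_arrow b\<^sub>2 = a\<^sub>1"

text \<open>Words are described by their first arrow and their length rather than as powers, because the
  words that occur need not consist of full periods.\<close>

primrec cyclic_word :: "arrow \<Rightarrow> nat \<Rightarrow> arrow list"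
  where
    "cyclic_word e 0 = []"
  | "cyclic_word e (Suc n) = e # cyclic_word (next_arrow e) n"

lemma length_cyclic_word [simp]: "length (cyclic_word e n) = n"
  by (induction n arbitrary: e) simp_all

lemma cyclic_word_add_period:
  "cyclic_word e (4 * r + n) = cyclic_word e (4 * r) @ cyclic_word e n"
proof (induction r)
  case (Suc r)
  have "next_arrow (next_arrow (next_arrow (next_arrow e))) = e" by (cases e) simp_all
  then have "cyclic_word e (4 + m) = cyclic_word e 4 @ cyclic_word e m" for m
    by (simp add: numeral_eq_Suc)
  from this[of "4 * r + n"] this[of "4 * r"] Suc
  have "cyclic_word e (4 + (4 * r + n)) = cyclic_word e (4 + 4 * r) @ cyclic_word e n"
    by simp
  moreover have "4 + (4 * r + n) = 4 * Suc r + n" "4 + 4 * r = 4 * Suc r" by simp_all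
  ultimately show ?case by (simp only:)
qed simp

lemma cyclic_word_concat:
  assumes "cyclic_word e 4 = p"
  shows "concat (replicate n p) = cyclic_word e (4 * n)"
proof (induction n)
  case (Suc n)
  then show ?case
    using assms cyclic_word_add_period[of e 1 "4 * n"] by simp
qed simp

definition has_zero_relation :: "arrow list \<Rightarrow> bool"
  where "has_zero_relation p \<longleftrightarrow> (\<exists>s t. p = s @ [a\<^sub>2, a\<^sub>1] @ t \<or> p = s @ [b\<^sub>2, b\<^sub>1] @ t)"

lemma has_zero_relation_Cons: "has_zero_relation p \<Longrightarrow> has_zero_relation (e # p)"
  unfolding has_zero_relation_def by (metis append_Cons)

lemma has_zero_relationI:
  "has_zero_relation (s @ a\<^sub>2 # a\<^sub>1 # t)" "has_zero_relation (s @ b\<^sub>2 # b\<^sub>1 # t)"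
  by (auto simp: has_zero_relation_def)

locale A_alg_presentation = finite_quiver K quiver for K :: "('k, 'm) ring_scheme" (structure) +
  fixes r :: nat
  assumes r_pos: "r > 0"
begin

text \<open>Going back along the same loop is forbidden, and each of the vertices 2 and 3 has a single
  outgoing arrow; so every arrow after the first is forced.\<close>

lemma cyclic_word_if_no_zero_relation:
  assumes "awalk u (e # p) w" "\<not> has_zero_relation (e # p)"
  shows "e # p = cyclic_word e (Suc (length p))"
  using assms
proof (induction p arbitrary: u e)
  case (Cons e' p)
  have walk: "awalk (head quiver e) (e' # p) w" and adj: "tail quiver e' = head quiver e"
    using Cons.prems(1) by (auto simp: awalk_Cons_iff)
  have "\<not> has_zero_relation (e' # p)"
    using Cons.prems(2) has_zero_relation_Cons by blast
  with Cons.IH[OF walk] have "e' # p = cyclic_word e' (Suc (length p))" .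
  moreover have "e' = next_arrow e"
    using adj Cons.prems(2) has_zero_relationI[of "[]" p] by (cases e; cases e'; simp)
  ultimately show ?case by simp
qed simp

text \<open>The two sides \<open>(a\<^sub>1 a\<^sub>2 b\<^sub>1 b\<^sub>2)\<^sup>r\<close> and \<open>(b\<^sub>1 b\<^sub>2 a\<^sub>1 a\<^sub>2)\<^sup>r\<close> of the third relation.\<close>

abbreviation "relA \<equiv> cyclic_word a\<^sub>1 (4 * r)"
abbreviation "relB \<equiv> cyclic_word b\<^sub>1 (4 * r)"
abbreviation "I \<equiv> genideal P (relations K r)"

lemma walk_relAB: "awalk 1 relA 1" "awalk 1 relB 1"
  and relations_eq: "relations K r = {path_elem (2, [a\<^sub>2, a\<^sub>1], 2), path_elem (3, [b\<^sub>2, b\<^sub>1], 3),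
    path_elem (1, relA, 1) \<ominus>\<^bsub>P\<^esub> path_elem (1, relB, 1)}"
proof -
  have A: "cyclic_word a\<^sub>1 4 = [a\<^sub>1, a\<^sub>2, b\<^sub>1, b\<^sub>2]" and B: "cyclic_word b\<^sub>1 4 = [b\<^sub>1, b\<^sub>2, a\<^sub>1, a\<^sub>2]"
    by (simp_all add: numeral_eq_Suc)
  have wA: "awalk 1 [a\<^sub>1, a\<^sub>2, b\<^sub>1, b\<^sub>2] 1" and wB: "awalk 1 [b\<^sub>1, b\<^sub>2, a\<^sub>1, a\<^sub>2] 1"
    by (simp_all add: awalk_simps)
  have arrow: "arrow_elem K quiver e = path_elem (tail quiver e, [e], head quiver e)" for e
    by (simp add: arrow_elem_def path_elem_def)
  note mult = path_elem_mult awalk_simps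
  show "awalk 1 relA 1" "awalk 1 relB 1"
    using path_elem_pow[OF wA r_pos] path_elem_pow[OF wB r_pos]
    by (simp_all add: cyclic_word_concat[OF A] cyclic_word_concat[OF B])
  show "relations K r = {path_elem (2, [a\<^sub>2, a\<^sub>1], 2), path_elem (3, [b\<^sub>2, b\<^sub>1], 3),
    path_elem (1, relA, 1) \<ominus>\<^bsub>P\<^esub> path_elem (1, relB, 1)}"
    using path_elem_pow[OF wA r_pos] path_elem_pow[OF wB r_pos]
    by (simp add: relations_def Let_def arrow mult cyclic_word_concat[OF A] cyclic_word_concat[OF B])
qed

text \<open>For \<open>r > 0\<close> all relations have positive degree.\<close>

lemma relations_subset_filt_1: "relations K r \<subseteq> P.filt 1"
proof -
  interpret F: ideal "P.filt 1" P by (rule P.filt_ideal)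
  have "path_elem (1, relA, 1) \<in> P.filt 1" "path_elem (1, relB, 1) \<in> P.filt 1"
    "path_elem (2, [a\<^sub>2, a\<^sub>1], 2) \<in> P.filt 1" "path_elem (3, [b\<^sub>2, b\<^sub>1], 3) \<in> P.filt 1"
    using r_pos walk_relAB by (auto intro!: path_elem_in_filt simp: awalk_simps)
  then show ?thesis
    unfolding relations_eq a_minus_def by (auto simp del: One_nat_def)
qed

lemma ideal_I: "ideal I P"
  using relations_subset_filt_1 by (intro P.A.genideal_ideal) (auto dest: P.filt_carrier)

lemma relations_in_I: "relations K r \<subseteq> I"
  using relations_subset_filt_1 by (intro P.A.genideal_self) (auto dest: P.filt_carrier)

lemma relations_homogeneous:
  assumes "s \<in> relations K r"
  shows "length_part n s \<in> I"
proof -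
  interpret I: ideal I P by (rule ideal_I)
  have "length_part n (path_elem (1, relA, 1) \<ominus>\<^bsub>P\<^esub> path_elem (1, relB, 1)) =
      (if n = 4 * r then path_elem (1, relA, 1) \<ominus>\<^bsub>P\<^esub> path_elem (1, relB, 1) else \<zero>\<^bsub>P\<^esub>)"
    unfolding P.part_diff[OF walk_relAB[THEN path_elem_closed]] length_part_path_elem length_cyclic_word
    by (auto simp: a_minus_def)
  then have "length_part n s = s \<or> length_part n s = \<zero>\<^bsub>P\<^esub>"
    using assms by (auto simp: relations_eq length_part_path_elem)
  then show ?thesis
    using assms relations_in_I I.zero_closed by auto
qed

lemma has_zero_relation_in_I:
  assumes walk: "awalk u p w" and "has_zero_relation p"
  shows "path_elem (u, p, w) \<in> I"
proof -
  interpret I: ideal I P by (rule ideal_I)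
  have factor: "path_elem (u, s @ q @ t, w) \<in> I"
    if "path_elem (x, q, x) \<in> I" "awalk u s x" "awalk x q x" "awalk x t w" for s q t x
    unfolding path_elem_mult3[OF that(2-4)]
    using that by (intro I.I_l_closed I.I_r_closed path_elem_closed)
  have mem: "path_elem (2, [a\<^sub>2, a\<^sub>1], 2) \<in> I" "path_elem (3, [b\<^sub>2, b\<^sub>1], 3) \<in> I"
    using relations_in_I unfolding relations_eq by auto
  obtain s t where "p = s @ [a\<^sub>2, a\<^sub>1] @ t \<or> p = s @ [b\<^sub>2, b\<^sub>1] @ t"
    using assms(2) unfolding has_zero_relation_def by blast
  then show ?thesis
  proof
    assume p: "p = s @ [a\<^sub>2, a\<^sub>1] @ t"
    have "awalk u s 2" "awalk 2 t w"
      using awalk_factor[of u s "[a\<^sub>2, a\<^sub>1]" t w 2 2] walk p by (auto simp: awalk_simps)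
    then show ?thesis
      unfolding p by (intro factor[OF mem(1)]) (simp_all add: awalk_simps)
  next
    assume p: "p = s @ [b\<^sub>2, b\<^sub>1] @ t"
    have "awalk u s 3" "awalk 3 t w"
      using awalk_factor[of u s "[b\<^sub>2, b\<^sub>1]" t w 3 3] walk p by (auto simp: awalk_simps)
    then show ?thesis
      unfolding p by (intro factor[OF mem(2)]) (simp_all add: awalk_simps)
  qed
qed

lemma exchange_relation_sides_in_I:
  assumes s: "awalk u s 1" and t: "awalk 1 t w"
  shows "path_elem (u, s @ relA @ t, w) \<in> I \<longleftrightarrow> path_elem (u, s @ relB @ t, w) \<in> I"
proof -
  interpret I: ideal I P by (rule ideal_I)
  note closed = path_elem_closed[OF s] path_elem_closed[OF t] walk_relAB[THEN path_elem_closed]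
  let ?A = "path_elem (u, s @ relA @ t, w)" and ?B = "path_elem (u, s @ relB @ t, w)"
  have AB: "?A \<in> carrier P" "?B \<in> carrier P"
    using s t walk_relAB by (auto intro!: path_elem_closed awalk_appendI simp del: awalk_append_iff)
  have "path_elem (1, relA, 1) \<ominus>\<^bsub>P\<^esub> path_elem (1, relB, 1) \<in> I"
    using relations_in_I unfolding relations_eq by auto
  then have "path_elem (u, s, 1) \<otimes>\<^bsub>P\<^esub> (path_elem (1, relA, 1) \<ominus>\<^bsub>P\<^esub> path_elem (1, relB, 1)) \<otimes>\<^bsub>P\<^esub>
      path_elem (1, t, w) \<in> I"
    using closed by (intro I.I_l_closed I.I_r_closed)
  also have "path_elem (u, s, 1) \<otimes>\<^bsub>P\<^esub> (path_elem (1, relA, 1) \<ominus>\<^bsub>P\<^esub> path_elem (1, relB, 1)) \<otimes>\<^bsub>P\<^esub>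
      path_elem (1, t, w) = ?A \<ominus>\<^bsub>P\<^esub> ?B"
    unfolding path_elem_mult3[OF s walk_relAB(1) t] path_elem_mult3[OF s walk_relAB(2) t]
    using closed by (simp add: a_minus_def P.A.r_distr P.A.l_distr P.A.r_minus P.A.l_minus)
  finally have "I +>\<^bsub>P\<^esub> ?A = I +>\<^bsub>P\<^esub> ?B"
    using P.quotient_coset_eq_iff[OF ideal_I AB] by blast
  then show ?thesis
    using P.quotient_coset_eq_zero_iff[OF ideal_I] AB by metis
qed

text \<open>A walk without zero relation is a cyclic word of length greater than \<open>4 r\<close>. If it starts with
  \<open>a\<^sub>1\<close> or \<open>b\<^sub>1\<close>, one side of the third relation is its initial segment, and exchanging it creates
  a zero relation with the arrow that follows. If it starts with \<open>a\<^sub>2\<close> or \<open>b\<^sub>2\<close>, that side begins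
  at the second arrow, and exchanging it creates a zero relation with the arrow in front of it.\<close>

lemma long_walk_in_I:
  assumes walk: "awalk u p w" and long: "4 * r + 1 \<le> length p"
  shows "path_elem (u, p, w) \<in> I"
proof (cases "has_zero_relation p")
  case True
  with walk show ?thesis by (rule has_zero_relation_in_I)
next
  case False
  obtain e p' where p: "p = e # p'"
    using long by (cases p) auto
  obtain n where n: "length p' = 4 * r + n"
    using long p by (metis add.commute length_Cons le_iff_add plus_1_eq_Suc Suc_le_mono)
  have cyc: "p = cyclic_word e (4 * r + Suc n)"
    using cyclic_word_if_no_zero_relation[of u e p' w] walk False p n by simp
  obtain m where m: "r = Suc m" using r_pos by (cases r) auto
  have relA: "relA = cyclic_word a\<^sub>1 (4 * m) @ [a\<^sub>1, a\<^sub>2, b\<^sub>1, b\<^sub>2]"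
    and relB: "relB = cyclic_word b\<^sub>1 (4 * m) @ [b\<^sub>1, b\<^sub>2, a\<^sub>1, a\<^sub>2]"
    using cyclic_word_add_period[of a\<^sub>1 m 4] cyclic_word_add_period[of b\<^sub>1 m 4]
    by (simp_all add: m numeral_eq_Suc add.commute)
  have hd: "\<exists>q. relA = a\<^sub>1 # q" "\<exists>q. relB = b\<^sub>1 # q"
    by (simp_all add: m numeral_eq_Suc)
  have "relA \<noteq> []" "relB \<noteq> []"
    using hd by auto
  note factorA = awalk_factor[OF _ walk_relAB(1) this(1)]
    and factorB = awalk_factor[OF _ walk_relAB(2) this(2)]
  have viaA: "path_elem (u, s @ relA @ t, w) \<in> I"
    if "awalk u (s @ relA @ t) w" "has_zero_relation (s @ relB @ t)" for s t
  proof -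
    note walks = factorA[OF that(1)]
    have "awalk u (s @ relB @ t) w"
      by (rule awalk_appendI[OF walks(1) awalk_appendI[OF walk_relAB(2) walks(2)]])
    with that(2) show ?thesis
      unfolding exchange_relation_sides_in_I[OF walks] by (intro has_zero_relation_in_I)
  qed
  have viaB: "path_elem (u, s @ relB @ t, w) \<in> I"
    if "awalk u (s @ relB @ t) w" "has_zero_relation (s @ relA @ t)" for s t
  proof -
    note walks = factorB[OF that(1)]
    have "awalk u (s @ relA @ t) w"
      by (rule awalk_appendI[OF walks(1) awalk_appendI[OF walk_relAB(1) walks(2)]])
    with that(2) show ?thesis
      unfolding exchange_relation_sides_in_I[OF walks, symmetric] by (intro has_zero_relation_in_I)
  qed
  show ?thesis
  proof (cases e)
    case a\<^sub>1
    then have p': "p = [] @ relA @ a\<^sub>1 # cyclic_word a\<^sub>2 n"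
      using cyc cyclic_word_add_period[of a\<^sub>1 r "Suc n"] by simp
    have "has_zero_relation ([] @ relB @ a\<^sub>1 # cyclic_word a\<^sub>2 n)"
      using has_zero_relationI(1)[of "cyclic_word b\<^sub>1 (4 * m) @ [b\<^sub>1, b\<^sub>2, a\<^sub>1]"] by (simp add: relB)
    with walk show ?thesis unfolding p' by (rule viaA)
  next
    case a\<^sub>2
    then have p': "p = [a\<^sub>2] @ relB @ cyclic_word b\<^sub>1 n"
      using cyc cyclic_word_add_period[of b\<^sub>1 r n] by simp
    have "has_zero_relation ([a\<^sub>2] @ relA @ cyclic_word b\<^sub>1 n)"
      using hd(1) has_zero_relationI(1)[of "[]"] by auto
    with walk show ?thesis unfolding p' by (rule viaB)
  next
    case b\<^sub>1
    then have p': "p = [] @ relB @ b\<^sub>1 # cyclic_word b\<^sub>2 n"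
      using cyc cyclic_word_add_period[of b\<^sub>1 r "Suc n"] by simp
    have "has_zero_relation ([] @ relA @ b\<^sub>1 # cyclic_word b\<^sub>2 n)"
      using has_zero_relationI(2)[of "cyclic_word a\<^sub>1 (4 * m) @ [a\<^sub>1, a\<^sub>2, b\<^sub>1]"] by (simp add: relA)
    with walk show ?thesis unfolding p' by (rule viaB)
  next
    case b\<^sub>2
    then have p': "p = [b\<^sub>2] @ relA @ cyclic_word a\<^sub>1 n"
      using cyc cyclic_word_add_period[of a\<^sub>1 r n] by simp
    have "has_zero_relation ([b\<^sub>2] @ relB @ cyclic_word a\<^sub>1 n)"
      using hd(2) has_zero_relationI(2)[of "[]"] by auto
    with walk show ?thesis unfolding p' by (rule viaA)
  qed
qed

theorem tightly_graded_A_alg: "tightly_graded K (A_alg K r)"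
  unfolding A_alg_def
  using relations_subset_filt_1 relations_homogeneous long_walk_in_I by (rule tightly_graded_path_algebra_quotient)

end

theorem proposition3p7:
  fixes K :: "('k, 'm) ring_scheme" and r :: nat
  assumes "algebraically_closed K"
    and "ring_char K = 2"
    and "r > 0"
  shows "tightly_graded K (A_alg K r)"
proof -
  have "field K"
    using assms(1) by (rule algebraically_closed.axioms)
  then have "A_alg_presentation K r"
    using fin_digraph_quiver assms(3)
    by (intro A_alg_presentation.intro finite_quiver.intro A_alg_presentation_axioms.intro)
  then show ?thesis
    by (rule A_alg_presentation.tightly_graded_A_alg)
qed

end
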